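(* Let $A$ be a linear relation in a finite-dimensional complex linear space $\mathfrak H$, let $\sigma_\pi(A)\cap\mathbb C=\{\lambda_1,\dots,\lambda_l\}$, and put $\mathfrak H(A)=\operatorname{dom}A+\operatorname{ran}A$. Then there exist a space $\mathfrak X_{\lambda_i}(A)$ spanned by a Jordan system of $A$ at $\lambda_i$ (for each $1\le i\le l$), a space $\mathfrak X_\infty(A)$ spanned by a Jordan system of $A$ at $\infty$ (with $\mathfrak X_\infty(A)=\{0\}$ if $\infty\notin\sigma_\pi(A)$), and a space $\mathfrak R_m(A)$ spanned by a shift system of $A$ (with $\mathfrak R_m(A)=\{0\}$ if $\mathfrak R_r(A)=\operatorname{dom}A+\operatorname{ran}A$), such that $$\mathfrak H(A)=\mathfrak R_c(A)\oplus\mathfrak X_{\lambda_1}(A)\oplus\cdots\oplus\mathfrak X_{\lambda_l}(A)\oplus\mathfrak X_\infty(A)\oplus\mathfrak R_m(A)$$ is a direct sum and such that the graph restrictions $A_S$, $J_{\lambda_1}(A),\dots,J_{\lambda_l}(A)$, $J_\infty(A)$, $A_M$ of $A$ to $\mathfrak R_c(A)$, $\mathfrak X_{\lambda_1}(A),\dots,\mathfrak X_{\lambda_l}(A)$, $\mathfrak X_\infty(A)$, $\mathfrak R_m(A)$, respectively (all contained in $A$), give a reducing sum decomposition $$A=A_S\oplus J_{\lambda_1}(A)\oplus\cdots\oplus J_{\lambda_l}(A)\oplus J_\infty(A)\oplus A_M$$ of $A$ with respect to this decomposition of $\mathfrak H(A)$. Furthermore: (a) $A_S$ is completely singular in $\mathfrak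 R_c(A)$; (b) $J_{\lambda_i}(A)$ is a Jordan operator in $\mathfrak X_{\lambda_i}(A)$ corresponding to $\lambda_i$, for $1\le i\le l$; (c) $J_\infty(A)$ is a Jordan relation in $\mathfrak X_\infty(A)$; (d) $A_M$ is a multishift in $\mathfrak R_m(A)$. Any of the relations in the decomposition is absent if the corresponding subspace is trivial (and the corresponding assertion in (a)-(d) is then void).
   Context: A linear relation $A$ in $\mathfrak H$ is a linear subspace of $\mathfrak H\times\mathfrak H$. Notation: $\operatorname{dom}A=\{x:\exists y,(x,y)\in A\}$, $\operatorname{ran}A=\{y:\exists x,(x,y)\in A\}$, $\ker A=\{x:(x,0)\in A\}$, $\operatorname{mul}A=\{y:(0,y)\in A\}$, $A^{-1}=\{(y,x):(x,y)\in A\}$, $AB=\{(x,y):\exists z,(x,z)\in B,(z,y)\in A\}$, $A^k=A\cdots A$ ($k$ factors), $A-\lambda=\{(x,y-\lambda x):(x,y)\in A\}$ for $\lambda\in\mathbb C$. Spectrum and root spaces: $\sigma_p(A)$ is the set of $\lambda\in\mathbb C$ with $\ker(A-\lambda)\ne\{0\}$, together with $\infty$ if $\operatorname{mul}A\neq\{0\}$. For $\lambda\in\mathbb C$, $\mathfrak R_\lambda(A)=\operatorname{span}\bigcup_{i\ge1}\ker(A-\lambda)^i$; $\mathfrak R_\infty(A)=\operatorname{span}\bigcup_{i\ge1}\operatorname{mul}A^i$; $\mathfrak R_c(A)=\mathfrak R_0(A)\cap\mathfrak R_\infty(A)$ (one has $\mathfrak R_c(A)\subset\mathfrak R_\lambda(A)$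 for all $\lambda\in\mathbb C\cup\{\infty\}$); $\mathfrak R_r(A)=\operatorname{span}\{\mathfrak R_\lambda(A):\lambda\in\mathbb C\cup\{\infty\}\}$. The proper point spectrum is $\sigma_\pi(A)=\{\lambda\in\sigma_p(A):\mathfrak R_\lambda(A)\setminus\mathfrak R_c(A)\ne\emptyset\}$; it is a finite set. The graph restriction of $A$ to a subspace $\mathfrak X$ is $A\cap(\mathfrak X\times\mathfrak X)$. A reducing sum decomposition of $A$ with respect to $(\mathfrak H_1,\dots,\mathfrak H_n)$ is a decomposition $A=A_1\oplus\cdots\oplus A_n$ (direct sum of subspaces of $\mathfrak H\times\mathfrak H$) where each $A_j$ is the graph restriction of $A$ to $\mathfrak H_j\subset\mathfrak H$ and the subspaces $\mathfrak H_1,\dots,\mathfrak H_n$ form a direct sum. A relation $A$ is completely singular if $A=A\cap(\mathfrak R_c(A)\times\mathfrak R_c(A))$. A relation $J$ in a space $\mathfrak X$ is a Jordan operator in $\mathfrak X$ corresponding to $\lambda\in\mathbb C$ if $\operatorname{dom}J=\mathfrak X$, $\operatorname{mul}J=\{0\}$ and $\sigma_p(J)=\{\lambda\}$; it is a Jordan relation in $\mathfrak X$ (corresponding to $\infty$) if $J^{-1}$ is a Jordan operator in $\mathfrak X$ corresponding to $0$. A multishift is a linear relation with $\sigma_p=\emptyset$ (no eigenvalues in $\mathbb C\cup\{\infty\}$). Jordan system at $\lambda\in\sigma_\pi(A)\cap\mathbb C$: put $\mathfrak Z_k(A,\lambda)=\dfrac{\ker(A-\lambda)^k+\mathfrak R_c(A)}{\ker(A-\lambda)^{k-1}+\mathfrak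 R_c(A)}$ for $k\ge1$ (with $\ker(A-\lambda)^0=\{0\}$), $W_k(\lambda)=\dim\mathfrak Z_k(A,\lambda)$, and $s(\lambda)=\min\{k\ge1:\ker(A-\lambda)^{k+1}+\mathfrak R_c(A)=\ker(A-\lambda)^k+\mathfrak R_c(A)\}$; then $(W_k(\lambda))_k$ is nonincreasing and vanishes for $k>s(\lambda)$. A Jordan system of $A$ at $\lambda$ is a family $\{x_k^i:1\le i\le W_k(\lambda),1\le k\le s(\lambda)\}$ such that $(x_k^i,x_{k-1}^i+\lambda x_k^i)\in A$ for all such $i,k$ (with $x_0^i=0$) and such that $\{[x_k^1],\dots,[x_k^{W_k(\lambda)}]\}$ is a basis of $\mathfrak Z_k(A,\lambda)$ for $1\le k\le s(\lambda)$. Jordan system at $\infty\in\sigma_\pi(A)$: put $\mathfrak W_k(A)=\dfrac{\operatorname{mul}A^k+\mathfrak R_c(A)}{\operatorname{mul}A^{k-1}+\mathfrak R_c(A)}$ for $k\ge1$ (with $\operatorname{mul}A^0=\{0\}$), $A_k=\dim\mathfrak W_k(A)$, $\aleph=\min\{k\ge1:\operatorname{mul}A^{k+1}+\mathfrak R_c(A)=\operatorname{mul}A^k+\mathfrak R_c(A)\}$. A Jordan system of $A$ at $\infty$ is a family $\{x_k^i:1\le i\le A_k,1\le k\le\aleph\}$ with $(x_{k-1}^i,x_k^i)\in A$ for all such $i,k$ (with $x_0^i=0$) and such that $\{[x_k^1],\dots,[x_k^{A_k}]\}$ is a basis of $\mathfrak W_k(A)$ for $1\le k\le\aleph$. Shift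 system (when $\mathfrak R_r(A)\subsetneq\operatorname{dom}A+\operatorname{ran}A$): put $\mathfrak M_0(A)=\dfrac{\operatorname{dom}A+\operatorname{ran}A}{\operatorname{ran}A+\mathfrak R_r(A)}$, $\mathfrak M_k(A)=\dfrac{\operatorname{ran}A^k+\mathfrak R_r(A)}{\operatorname{ran}A^{k+1}+\mathfrak R_r(A)}$ for $k\ge1$, $C_k=\dim\mathfrak M_k(A)$, $m=\min\{k\ge1:\operatorname{ran}A^{k+1}+\mathfrak R_r(A)=\operatorname{ran}A^k+\mathfrak R_r(A)\}$. A shift system of $A$ is a family $\{x_k^i:1\le i\le C_k,0\le k\le m-1\}$ with $(x_{k-1}^i,x_k^i)\in A$ for $1\le k\le m-1$, $1\le i\le C_k$, and such that $\{[x_k^1],\dots,[x_k^{C_k}]\}$ is a basis of $\mathfrak M_k(A)$ for $0\le k\le m-1$. *)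

theory Defs
  imports "HOL-Analysis.Product_Vector" "HOL-Library.Set_Algebras"
begin

text \<open>
  A complex linear space is given by a scalar multiplication \<open>s\<close> on an additive group, as in
  the locale \<^locale>\<open>vector_space\<close>. Sums of subspaces are the pointwise sums \<open>U + V\<close> of
  \<open>HOL-Library.Set_Algebras\<close>, and \<open>x +o V\<close> is the coset \<open>x + V\<close>.
\<close>

datatype excomplex = Fin complex | Infty

section \<open>Linear relations\<close>

definition linear_relation_in ::
  "(complex \<Rightarrow> 'v::ab_group_add \<Rightarrow> 'v) \<Rightarrow> 'v set \<Rightarrow> ('v \<times> 'v) set \<Rightarrow> bool" where
  "linear_relation_in s X A \<longleftrightarrow> module.subspace (module_prod.scale s s) A \<and> A \<subseteq> X \<times> X"

text \<open>
  Domain, range, inverse and powers of a relation are those of the library. The power \<open>A ^^ 0\<close> is the identity relation, so that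
  the conventions \<open>rel_ker (A ^^ 0) = {0}\<close> and \<open>rel_mul (A ^^ 0) = {0}\<close> hold automatically.
\<close>

definition rel_ker :: "('v::ab_group_add \<times> 'v) set \<Rightarrow> 'v set" where
  "rel_ker A = {x. (x, 0) \<in> A}"

definition rel_mul :: "('v::ab_group_add \<times> 'v) set \<Rightarrow> 'v set" where
  "rel_mul A = {y. (0, y) \<in> A}"

definition rel_minus ::
  "(complex \<Rightarrow> 'v::ab_group_add \<Rightarrow> 'v) \<Rightarrow> ('v \<times> 'v) set \<Rightarrow> complex \<Rightarrow> ('v \<times> 'v) set" where
  "rel_minus s A c = {(x, y - s c x) | x y. (x, y) \<in> A}"

definition graph_restriction :: "('v \<times> 'v) set \<Rightarrow> 'v set \<Rightarrow> ('v \<times> 'v) set" where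
  "graph_restriction A X = A \<inter> (X \<times> X)"

section \<open>Spectrum and root spaces\<close>

definition point_spectrum ::
  "(complex \<Rightarrow> 'v::ab_group_add \<Rightarrow> 'v) \<Rightarrow> ('v \<times> 'v) set \<Rightarrow> excomplex set" where
  "point_spectrum s A =
     {Fin c | c. rel_ker (rel_minus s A c) \<noteq> {0}} \<union> (if rel_mul A \<noteq> {0} then {Infty} else {})"

fun root_space ::
  "(complex \<Rightarrow> 'v::ab_group_add \<Rightarrow> 'v) \<Rightarrow> ('v \<times> 'v) set \<Rightarrow> excomplex \<Rightarrow> 'v set" where
  "root_space s A (Fin c) = module.span s (\<Union>i\<in>{1..}. rel_ker (rel_minus s A c ^^ i))"
| "root_space s A Infty = module.span s (\<Union>i\<in>{1..}. rel_mul (A ^^ i))"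

definition singular_chain_space ::
  "(complex \<Rightarrow> 'v::ab_group_add \<Rightarrow> 'v) \<Rightarrow> ('v \<times> 'v) set \<Rightarrow> 'v set" where
  "singular_chain_space s A = root_space s A (Fin 0) \<inter> root_space s A Infty"

definition total_root_space ::
  "(complex \<Rightarrow> 'v::ab_group_add \<Rightarrow> 'v) \<Rightarrow> ('v \<times> 'v) set \<Rightarrow> 'v set" where
  "total_root_space s A = module.span s (\<Union>z. root_space s A z)"

definition proper_point_spectrum ::
  "(complex \<Rightarrow> 'v::ab_group_add \<Rightarrow> 'v) \<Rightarrow> ('v \<times> 'v) set \<Rightarrow> excomplex set" where
  "proper_point_spectrum s A =
     {z \<in> point_spectrum s A. root_space s A z - singular_chain_space s A \<noteq> {}}"

section \<open>Classes of relations\<close>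

definition completely_singular_in ::
  "(complex \<Rightarrow> 'v::ab_group_add \<Rightarrow> 'v) \<Rightarrow> 'v set \<Rightarrow> ('v \<times> 'v) set \<Rightarrow> bool" where
  "completely_singular_in s X A \<longleftrightarrow> linear_relation_in s X A \<and>
     A = A \<inter> (singular_chain_space s A \<times> singular_chain_space s A)"

definition jordan_operator_in ::
  "(complex \<Rightarrow> 'v::ab_group_add \<Rightarrow> 'v) \<Rightarrow> 'v set \<Rightarrow> complex \<Rightarrow> ('v \<times> 'v) set \<Rightarrow> bool" where
  "jordan_operator_in s X c J \<longleftrightarrow> linear_relation_in s X J \<and>
     Domain J = X \<and> rel_mul J = {0} \<and> point_spectrum s J = {Fin c}"

definition jordan_relation_in ::
  "(complex \<Rightarrow> 'v::ab_group_add \<Rightarrow> 'v) \<Rightarrow> 'v set \<Rightarrow> ('v \<times> 'v) set \<Rightarrow> bool" where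
  "jordan_relation_in s X J \<longleftrightarrow> jordan_operator_in s X 0 (J\<inverse>)"

definition multishift_in ::
  "(complex \<Rightarrow> 'v::ab_group_add \<Rightarrow> 'v) \<Rightarrow> 'v set \<Rightarrow> ('v \<times> 'v) set \<Rightarrow> bool" where
  "multishift_in s X A \<longleftrightarrow> linear_relation_in s X A \<and> point_spectrum s A = {}"

section \<open>Quotient spaces\<close>

text \<open>
  The elements of \<open>U / V\<close>, for subspaces \<open>V \<subseteq> U\<close>, are the cosets \<open>x +o V\<close> with \<open>x \<in> U\<close>. Their
  addition is pointwise addition of sets. The summand \<open>V\<close> in the scalar multiple matters only for
  the scalar 0, where the image of a coset is \<open>{0}\<close>; the summand \<open>V\<close> in a linear combination
  matters only for the empty sum, which is \<open>{0}\<close> in \<open>HOL-Library.Set_Algebras\<close>. In both cases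
  the zero of the quotient space is \<open>V\<close>.
\<close>

definition quotient_space :: "'v::ab_group_add set \<Rightarrow> 'v set \<Rightarrow> 'v set set" where
  "quotient_space U V = (\<lambda>x. x +o V) ` U"

definition coset_scale ::
  "(complex \<Rightarrow> 'v::ab_group_add \<Rightarrow> 'v) \<Rightarrow> 'v set \<Rightarrow> complex \<Rightarrow> 'v set \<Rightarrow> 'v set" where
  "coset_scale s V c Q = s c ` Q + V"

definition coset_lincomb ::
  "(complex \<Rightarrow> 'v::ab_group_add \<Rightarrow> 'v) \<Rightarrow> 'v set \<Rightarrow> nat \<Rightarrow> (nat \<Rightarrow> complex) \<Rightarrow> (nat \<Rightarrow> 'v set) \<Rightarrow> 'v set"
  where "coset_lincomb s V n c b = (\<Sum>i\<in>{1..n}. coset_scale s V (c i) (b i)) + V"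

definition quotient_basis ::
  "(complex \<Rightarrow> 'v::ab_group_add \<Rightarrow> 'v) \<Rightarrow> 'v set \<Rightarrow> 'v set \<Rightarrow> nat \<Rightarrow> (nat \<Rightarrow> 'v set) \<Rightarrow> bool" where
  "quotient_basis s U V n b \<longleftrightarrow>
     (\<forall>i\<in>{1..n}. b i \<in> quotient_space U V) \<and>
     (\<forall>c. coset_lincomb s V n c b = V \<longrightarrow> (\<forall>i\<in>{1..n}. c i = 0)) \<and>
     (\<forall>Q\<in>quotient_space U V. \<exists>c. Q = coset_lincomb s V n c b)"

definition quotient_dim ::
  "(complex \<Rightarrow> 'v::ab_group_add \<Rightarrow> 'v) \<Rightarrow> 'v set \<Rightarrow> 'v set \<Rightarrow> nat" where
  "quotient_dim s U V = (THE n. \<exists>b. quotient_basis s U V n b)"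

section \<open>Jordan systems and shift systems\<close>

text \<open>
  The vector \<open>x\<^sub>k\<^sup>i\<close> is written \<open>x k i\<close>. Jordan systems consist of the vectors with \<open>1 \<le> k\<close>; the
  value \<open>x 0 i = 0\<close> is only a convention. Values of \<open>x\<close> outside the index range are irrelevant.
\<close>

definition ker_chain_space ::
  "(complex \<Rightarrow> 'v::ab_group_add \<Rightarrow> 'v) \<Rightarrow> ('v \<times> 'v) set \<Rightarrow> complex \<Rightarrow> nat \<Rightarrow> 'v set" where
  "ker_chain_space s A c k = rel_ker (rel_minus s A c ^^ k) + singular_chain_space s A"

definition weyr_dim ::
  "(complex \<Rightarrow> 'v::ab_group_add \<Rightarrow> 'v) \<Rightarrow> ('v \<times> 'v) set \<Rightarrow> complex \<Rightarrow> nat \<Rightarrow> nat" where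
  "weyr_dim s A c k = quotient_dim s (ker_chain_space s A c k) (ker_chain_space s A c (k - 1))"

definition jordan_length ::
  "(complex \<Rightarrow> 'v::ab_group_add \<Rightarrow> 'v) \<Rightarrow> ('v \<times> 'v) set \<Rightarrow> complex \<Rightarrow> nat" where
  "jordan_length s A c =
     (LEAST k. 1 \<le> k \<and> ker_chain_space s A c (k + 1) = ker_chain_space s A c k)"

definition jordan_system ::
  "(complex \<Rightarrow> 'v::ab_group_add \<Rightarrow> 'v) \<Rightarrow> ('v \<times> 'v) set \<Rightarrow> complex \<Rightarrow> (nat \<Rightarrow> nat \<Rightarrow> 'v) \<Rightarrow> bool" where
  "jordan_system s A c x \<longleftrightarrow> (\<forall>i. x 0 i = 0) \<and>
     (\<forall>k\<in>{1..jordan_length s A c}.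
        (\<forall>i\<in>{1..weyr_dim s A c k}. (x k i, x (k - 1) i + s c (x k i)) \<in> A) \<and>
        quotient_basis s (ker_chain_space s A c k) (ker_chain_space s A c (k - 1))
          (weyr_dim s A c k) (\<lambda>i. x k i +o ker_chain_space s A c (k - 1)))"

definition jordan_system_span ::
  "(complex \<Rightarrow> 'v::ab_group_add \<Rightarrow> 'v) \<Rightarrow> ('v \<times> 'v) set \<Rightarrow> complex \<Rightarrow> (nat \<Rightarrow> nat \<Rightarrow> 'v) \<Rightarrow> 'v set" where
  "jordan_system_span s A c x =
     module.span s {x k i | k i. k \<in> {1..jordan_length s A c} \<and> i \<in> {1..weyr_dim s A c k}}"

definition mul_chain_space ::
  "(complex \<Rightarrow> 'v::ab_group_add \<Rightarrow> 'v) \<Rightarrow> ('v \<times> 'v) set \<Rightarrow> nat \<Rightarrow> 'v set" where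
  "mul_chain_space s A k = rel_mul (A ^^ k) + singular_chain_space s A"

definition weyr_dim_inf ::
  "(complex \<Rightarrow> 'v::ab_group_add \<Rightarrow> 'v) \<Rightarrow> ('v \<times> 'v) set \<Rightarrow> nat \<Rightarrow> nat" where
  "weyr_dim_inf s A k = quotient_dim s (mul_chain_space s A k) (mul_chain_space s A (k - 1))"

definition jordan_length_inf ::
  "(complex \<Rightarrow> 'v::ab_group_add \<Rightarrow> 'v) \<Rightarrow> ('v \<times> 'v) set \<Rightarrow> nat" where
  "jordan_length_inf s A =
     (LEAST k. 1 \<le> k \<and> mul_chain_space s A (k + 1) = mul_chain_space s A k)"

definition jordan_system_inf ::
  "(complex \<Rightarrow> 'v::ab_group_add \<Rightarrow> 'v) \<Rightarrow> ('v \<times> 'v) set \<Rightarrow> (nat \<Rightarrow> nat \<Rightarrow> 'v) \<Rightarrow> bool" where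
  "jordan_system_inf s A x \<longleftrightarrow> (\<forall>i. x 0 i = 0) \<and>
     (\<forall>k\<in>{1..jordan_length_inf s A}.
        (\<forall>i\<in>{1..weyr_dim_inf s A k}. (x (k - 1) i, x k i) \<in> A) \<and>
        quotient_basis s (mul_chain_space s A k) (mul_chain_space s A (k - 1))
          (weyr_dim_inf s A k) (\<lambda>i. x k i +o mul_chain_space s A (k - 1)))"

definition jordan_system_inf_span ::
  "(complex \<Rightarrow> 'v::ab_group_add \<Rightarrow> 'v) \<Rightarrow> ('v \<times> 'v) set \<Rightarrow> (nat \<Rightarrow> nat \<Rightarrow> 'v) \<Rightarrow> 'v set" where
  "jordan_system_inf_span s A x =
     module.span s {x k i | k i. k \<in> {1..jordan_length_inf s A} \<and> i \<in> {1..weyr_dim_inf s A k}}"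

text \<open>
  The spaces \<open>shift_chain_space s A k\<close> are \<open>dom A + ran A\<close> for \<open>k = 0\<close> (to which the root spaces
  add nothing) and \<open>ran (A ^^ k)\<close> plus the root spaces for \<open>k \<ge> 1\<close>.
\<close>

definition shift_chain_space ::
  "(complex \<Rightarrow> 'v::ab_group_add \<Rightarrow> 'v) \<Rightarrow> ('v \<times> 'v) set \<Rightarrow> nat \<Rightarrow> 'v set" where
  "shift_chain_space s A k =
     (if k = 0 then Domain A + Range A else Range (A ^^ k) + total_root_space s A)"

definition shift_dim ::
  "(complex \<Rightarrow> 'v::ab_group_add \<Rightarrow> 'v) \<Rightarrow> ('v \<times> 'v) set \<Rightarrow> nat \<Rightarrow> nat" where
  "shift_dim s A k = quotient_dim s (shift_chain_space s A k) (shift_chain_space s A (k + 1))"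

definition shift_length ::
  "(complex \<Rightarrow> 'v::ab_group_add \<Rightarrow> 'v) \<Rightarrow> ('v \<times> 'v) set \<Rightarrow> nat" where
  "shift_length s A =
     (LEAST k. 1 \<le> k \<and> shift_chain_space s A (k + 1) = shift_chain_space s A k)"

definition shift_system ::
  "(complex \<Rightarrow> 'v::ab_group_add \<Rightarrow> 'v) \<Rightarrow> ('v \<times> 'v) set \<Rightarrow> (nat \<Rightarrow> nat \<Rightarrow> 'v) \<Rightarrow> bool" where
  "shift_system s A x \<longleftrightarrow>
     (\<forall>k\<in>{1..shift_length s A - 1}. \<forall>i\<in>{1..shift_dim s A k}. (x (k - 1) i, x k i) \<in> A) \<and>
     (\<forall>k\<in>{0..shift_length s A - 1}.
        quotient_basis s (shift_chain_space s A k) (shift_chain_space s A (k + 1))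
          (shift_dim s A k) (\<lambda>i. x k i +o shift_chain_space s A (k + 1)))"

definition shift_system_span ::
  "(complex \<Rightarrow> 'v::ab_group_add \<Rightarrow> 'v) \<Rightarrow> ('v \<times> 'v) set \<Rightarrow> (nat \<Rightarrow> nat \<Rightarrow> 'v) \<Rightarrow> 'v set" where
  "shift_system_span s A x =
     module.span s {x k i | k i. k \<in> {0..shift_length s A - 1} \<and> i \<in> {1..shift_dim s A k}}"

section \<open>Direct sums and reducing sum decompositions\<close>

definition independent_subspaces :: "'a::ab_group_add set list \<Rightarrow> bool" where
  "independent_subspaces Us \<longleftrightarrow>
     (\<forall>us. length us = length Us \<and> (\<forall>j<length Us. us ! j \<in> Us ! j) \<and> sum_list us = 0 \<longrightarrow>
        (\<forall>j<length Us. us ! j = 0))"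

definition is_direct_sum :: "'a::ab_group_add set \<Rightarrow> 'a set list \<Rightarrow> bool" where
  "is_direct_sum U Us \<longleftrightarrow> U = sum_list Us \<and> independent_subspaces Us"

definition reducing_sum_decomposition ::
  "(complex \<Rightarrow> 'v::ab_group_add \<Rightarrow> 'v) \<Rightarrow> ('v \<times> 'v) set \<Rightarrow> 'v set list \<Rightarrow> ('v \<times> 'v) set list \<Rightarrow> bool"
  where
  "reducing_sum_decomposition s A Hs As \<longleftrightarrow>
     (\<forall>H\<in>set Hs. module.subspace s H) \<and> independent_subspaces Hs \<and>
     As = map (graph_restriction A) Hs \<and> is_direct_sum A As"

end

(*
  The elements of chains of B = A - c that end in 0 form the root space of A at c, and those of
  the inverse of A form the root space at infinity. Modulo the root space at infinity A is
  single-valued, so that the root spaces are independent modulo R_c as for an operator. Modulo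
  R_r the relation A has no eigenvalues at all, infinity included; as every chain of more than
  dim H vectors satisfies a polynomial relation, whose roots can be split off one by one, ran A^k
  is contained in R_r for large k.

  Jordan systems and shift systems are built from the top level down: the images of a basis at
  one level are independent at the next one and are extended to a basis there. Any choice of
  these systems gives the decomposition. A pair (x, y) in A is reduced by subtracting first
  chains of the shift system, until y and hence x lie in R_r, and then the images of the
  components of x in the Jordan spaces and in R_c, until only a pair at infinity is left.
*)

theory Submission
  imports Defs "HOL-Computational_Algebra.Fundamental_Theorem_Algebra"
begin

text \<open>The obstacle is that \<open>A\<close> is neither everywhere defined nor single-valued,
  so root spaces are not invariant in the usual sense. One-sided facts take the place of invariance.
  In the root space of \<open>A\<close> at \<open>c\<close>, every vector has an image under
  \<open>A - c\<close> that lies there, and every preimage under \<open>A - c\<close> of one of its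
  vectors lies there. At infinity the roles are exchanged: preimages exist inside the space, and all
  images stay inside. In \<open>R_c\<close> both images and preimages exist inside, but neither need
  stay there. This decides from which side a pair \<open>(x, y)\<close> can be reduced: from
  \<open>y\<close> where preimages are at hand (shift chains above their first vector, the Jordan
  space at infinity), from \<open>x\<close> where images are (the finite Jordan spaces).
  \<open>R_c\<close> can absorb a remainder on either side. \<open>R_c\<close> is defined through 0
  and infinity only. That it is the same space for every \<open>A - c\<close> must be proved, and it
  is what lets all finite Jordan systems be built from \<open>B = A - c\<close> alone. The system at
  infinity is the one of the inverse at 0.\<close>

locale complex_fd_space = finite_dimensional_vector_space s Basis
  for s :: "complex \<Rightarrow> 'v::ab_group_add \<Rightarrow> 'v" and Basis :: "'v set"
begin

lemma subspace_sum_sets: "subspace U \<Longrightarrow> subspace V \<Longrightarrow> subspace (U + V)"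
  using subspace_sums[of U V] by (simp add: set_plus_def Bex_def conj_commute conj_left_commute)

lemma set_plus_subset_subspace: "subspace W \<Longrightarrow> U \<subseteq> W \<Longrightarrow> V \<subseteq> W \<Longrightarrow> U + V \<subseteq> W"
  by (blast elim: set_plus_elim intro: subspace_add)

section \<open>Bases relative to a subspace\<close>

definition lincomb :: "nat \<Rightarrow> (nat \<Rightarrow> 'v) \<Rightarrow> (nat \<Rightarrow> complex) \<Rightarrow> 'v" where
  "lincomb n x c = (\<Sum>i\<in>{1..n}. s (c i) (x i))"

text \<open>Independence and bases in \<open>U / V\<close> are expressed by representatives, because
  chain systems consist of vectors and a choice inside each coset has to be controlled.
  \<open>quotient_basis_iff\<close> returns to cosets.\<close>

definition rel_indep :: "'v set \<Rightarrow> nat \<Rightarrow> (nat \<Rightarrow> 'v) \<Rightarrow> bool" where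
  "rel_indep V n x \<longleftrightarrow> (\<forall>c. lincomb n x c \<in> V \<longrightarrow> (\<forall>i\<in>{1..n}. c i = 0))"

definition rel_basis :: "'v set \<Rightarrow> 'v set \<Rightarrow> nat \<Rightarrow> (nat \<Rightarrow> 'v) \<Rightarrow> bool" where
  "rel_basis U V n x \<longleftrightarrow>
     (\<forall>i\<in>{1..n}. x i \<in> U) \<and> rel_indep V n x \<and> (\<forall>u\<in>U. \<exists>c. u - lincomb n x c \<in> V)"

lemma lincomb_0 [simp]: "lincomb 0 x c = 0"
  by (simp add: lincomb_def)

lemma lincomb_Suc: "lincomb (Suc n) x c = lincomb n x c + s (c (Suc n)) (x (Suc n))"
  by (simp add: lincomb_def)

lemma lincomb_cong:
  "(\<And>i. i \<in> {1..n} \<Longrightarrow> c i = d i) \<Longrightarrow> (\<And>i. i \<in> {1..n} \<Longrightarrow> x i = y i) \<Longrightarrow>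
    lincomb n x c = lincomb n y d"
  unfolding lincomb_def by (rule sum.cong) auto

lemma lincomb_add: "lincomb n x (\<lambda>i. c i + d i) = lincomb n x c + lincomb n x d"
  by (simp add: lincomb_def scale_left_distrib sum.distrib)

lemma lincomb_scale: "lincomb n x (\<lambda>i. a * c i) = s a (lincomb n x c)"
  by (simp add: lincomb_def scale_sum_right)

lemma lincomb_mem: "subspace U \<Longrightarrow> (\<And>i. i \<in> {1..n} \<Longrightarrow> x i \<in> U) \<Longrightarrow> lincomb n x c \<in> U"
  unfolding lincomb_def by (intro subspace_sum subspace_scale) auto

lemma subspace_lincombs: "subspace (range (lincomb n x))"
proof (rule subspaceI)
  have "lincomb n x (\<lambda>_. 0) = 0" by (simp add: lincomb_def)
  then show "0 \<in> range (lincomb n x)" by (metis rangeI)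
  show "a + b \<in> range (lincomb n x)" if "a \<in> range (lincomb n x)" "b \<in> range (lincomb n x)" for a b
    using that by (auto simp: lincomb_add[symmetric])
  show "s k a \<in> range (lincomb n x)" if "a \<in> range (lincomb n x)" for k a
    using that by (auto simp: lincomb_scale[symmetric])
qed

lemma lincomb_single:
  assumes "i \<in> {1..n}"
  shows "lincomb n x (\<lambda>j. if j = i then 1 else 0) = x i"
proof -
  have "lincomb n x (\<lambda>j. if j = i then 1 else 0) = (\<Sum>j\<in>{1..n}. if j = i then x j else 0)"
    unfolding lincomb_def by (rule sum.cong) auto
  then show ?thesis using assms by simp
qed

lemma span_eq_lincombs: "span (x ` {1..n}) = range (lincomb n x)"
proof
  show "span (x ` {1..n}) \<subseteq> range (lincomb n x)"
    by (rule span_minimal[OF _ subspace_lincombs]) (use lincomb_single[symmetric] in blast)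
  show "range (lincomb n x) \<subseteq> span (x ` {1..n})"
    by (intro image_subsetI lincomb_mem) (auto intro: span_base)
qed

lemma rel_indep_Suc:
  assumes V: "subspace V" and x: "rel_indep V n x" and p: "p \<notin> V + span (x ` {1..n})"
  shows "rel_indep V (Suc n) (x(Suc n := p))"
  unfolding rel_indep_def
proof (intro allI impI)
  fix c assume c: "lincomb (Suc n) (x(Suc n := p)) c \<in> V"
  have eq: "lincomb (Suc n) (x(Suc n := p)) c = lincomb n x c + s (c (Suc n)) p"
    by (auto simp: lincomb_Suc intro: lincomb_cong)
  have "c (Suc n) = 0"
  proof (rule ccontr)
    assume nz: "c (Suc n) \<noteq> 0"
    let ?v = "lincomb n x c + s (c (Suc n)) p"
    have "p = s (inverse (c (Suc n))) ?v + s (- inverse (c (Suc n))) (lincomb n x c)"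
      using nz by (simp add: scale_right_distrib scale_minus_left)
    moreover have "s (inverse (c (Suc n))) ?v \<in> V"
      using c eq V subspace_scale by metis
    moreover have "s (- inverse (c (Suc n))) (lincomb n x c) \<in> span (x ` {1..n})"
      unfolding span_eq_lincombs lincomb_scale[symmetric] by (rule rangeI)
    ultimately show False using p by (metis set_plus_intro)
  qed
  then have "lincomb n x c \<in> V" using c eq by simp
  then show "\<forall>i\<in>{1..Suc n}. c i = 0"
    using x \<open>c (Suc n) = 0\<close> unfolding rel_indep_def by (auto simp: le_Suc_eq)
qed

lemma rel_indep_SucD:
  assumes "rel_indep V (Suc n) x"
  shows "rel_indep V n x" 
  unfolding rel_indep_def
proof (intro allI impI ballI)
  fix c i assume c: "lincomb n x c \<in> V" and i: "i \<in> {1..n}"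
  have "lincomb (Suc n) x (c(Suc n := 0)) = lincomb n x c"
    by (auto simp: lincomb_Suc intro: lincomb_cong)
  then have "(c(Suc n := 0)) i = 0" using assms c i unfolding rel_indep_def
    by (metis atLeastAtMost_iff le_Suc_eq)
  then show "c i = 0" using i by auto
qed

lemma rel_indep_Suc_notin:
  assumes V: "subspace V" and "rel_indep V (Suc n) x"
  shows "x (Suc n) \<notin> V + span (x ` {1..n})"
proof
  assume "x (Suc n) \<in> V + span (x ` {1..n})"
  then obtain v c where v: "v \<in> V" "x (Suc n) = v + lincomb n x c"
    unfolding span_eq_lincombs by (auto elim!: set_plus_elim)
  define d where "d = (\<lambda>i. - 1 * c i)(Suc n := 1)"
  have "lincomb (Suc n) x d = lincomb n x (\<lambda>i. - 1 * c i) + x (Suc n)"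
    by (auto simp: lincomb_Suc d_def intro: lincomb_cong)
  also have "\<dots> = v" unfolding lincomb_scale using v by (simp add: scale_minus_left)
  finally have "d (Suc n) = 0" using assms(2) v unfolding rel_indep_def
    by (metis atLeastAtMost_iff le_add1 le_refl plus_1_eq_Suc)
  then show False by (simp add: d_def)
qed

text \<open>Each further vector lies outside the space reached so far, so it raises the dimension by
  exactly one. This reduces dimensions of quotients to differences of \<open>dim\<close>.\<close>

lemma dim_plus_rel_indep:
  assumes V: "subspace V" and "rel_indep V n x"
  shows "dim (V + span (x ` {1..n})) = dim V + n"
  using assms(2)
proof (induction n)
  case 0
  then show ?case by simp
next
  case (Suc n)
  let ?W = "V + span (x ` {1..n})"
  have W: "subspace ?W" using V subspace_sum_sets by blast
  have "V + span (x ` {1..Suc n}) = span (insert (x (Suc n)) ?W)" (is "_ = ?R")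
  proof
    have "span (x ` {1..Suc n}) \<subseteq> ?R"
    proof (rule span_minimal)
      have "?W \<subseteq> ?R" by (meson span_superset subset_insertI subset_trans)
      moreover have "x i \<in> ?W" if "i \<in> {1..n}" for i
        using that V by (metis (no_types, lifting) add_0 imageI set_plus_intro span_base subspace_0)
      ultimately show "x ` {1..Suc n} \<subseteq> ?R"
        by (auto simp: atLeastAtMostSuc_conv span_base)
    qed auto
    moreover have "V \<subseteq> ?R"
      by (metis (no_types, lifting) add_0_right insert_iff set_plus_intro span_base span_zero subsetI)
    ultimately show "V + span (x ` {1..Suc n}) \<subseteq> ?R"
      by (auto elim!: set_plus_elim intro!: span_add)
    show "?R \<subseteq> V + span (x ` {1..Suc n})"
    proof (rule span_minimal)
      have "x (Suc n) \<in> V + span (x ` {1..Suc n})"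
        using V by (metis add_0 atLeastAtMost_iff imageI le_add1 order_refl plus_1_eq_Suc set_plus_intro span_base subspace_0)
      moreover have "?W \<subseteq> V + span (x ` {1..Suc n})"
        by (intro set_plus_mono2 span_mono) auto
      ultimately show "insert (x (Suc n)) ?W \<subseteq> V + span (x ` {1..Suc n})" by blast
    qed (use V subspace_sum_sets in blast)
  qed
  moreover have "x (Suc n) \<notin> span ?W"
    using rel_indep_Suc_notin[OF V Suc.prems] W by (simp add: span_eq_iff[THEN iffD2])
  ultimately show ?case
    using Suc.IH[OF rel_indep_SucD[OF Suc.prems]] by (simp add: dim_insert)
qed

lemma rel_basis_dim:
  assumes U: "subspace U" and V: "subspace V" "V \<subseteq> U" and b: "rel_basis U V n x"
  shows "n = dim U - dim V"
proof -
  have "V + span (x ` {1..n}) = U"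
  proof
    have "span (x ` {1..n}) \<subseteq> U" using b U unfolding rel_basis_def by (intro span_minimal) auto
    then show "V + span (x ` {1..n}) \<subseteq> U"
      using V U by (auto elim!: set_plus_elim intro: subspace_add)
    show "U \<subseteq> V + span (x ` {1..n})"
    proof
      fix u assume "u \<in> U"
      then obtain c where "u - lincomb n x c \<in> V" using b unfolding rel_basis_def by blast
      then have "(u - lincomb n x c) + lincomb n x c \<in> V + span (x ` {1..n})"
        unfolding span_eq_lincombs by (intro set_plus_intro rangeI)
      then show "u \<in> V + span (x ` {1..n})" by simp
    qed
  qed
  then show ?thesis using dim_plus_rel_indep[of V n x] b V unfolding rel_basis_def by simp
qed

text \<open>Steinitz extension in \<open>U / V\<close> with a side condition: new vectors come from
  \<open>P\<close>, which meets every coset. In the applications \<open>P\<close> holds the vectors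
  from which a chain can be continued, so the completed basis can again be carried to the next
  level.\<close>

lemma rel_basis_extend:
  assumes U: "subspace U" and V: "subspace V" "V \<subseteq> U" and P: "P \<subseteq> U"
    and PU: "\<And>u. u \<in> U \<Longrightarrow> \<exists>p\<in>P. u - p \<in> V"
    and x: "\<And>i. i \<in> {1..p} \<Longrightarrow> x i \<in> P" "rel_indep V p x"
  shows "p \<le> dim U - dim V \<and> (\<exists>y. rel_basis U V (dim U - dim V) y \<and>
    (\<forall>i\<in>{1..p}. y i = x i) \<and> (\<forall>i\<in>{1..dim U - dim V}. y i \<in> P))"
  using x
proof (induction "dim U - dim V - p" arbitrary: p x rule: less_induct)
  case less
  let ?W = "V + span (x ` {1..p})"
  have "span (x ` {1..p}) \<subseteq> U" using less.prems P U by (intro span_minimal) auto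
  then have WU: "?W \<subseteq> U" using V U by (auto elim!: set_plus_elim intro: subspace_add)
  have dimW: "dim ?W = dim V + p" using dim_plus_rel_indep[OF V(1) less.prems(2)] .
  with WU have le: "p \<le> dim U - dim V" using dim_subset[OF WU] by linarith
  show ?case
  proof (cases "U \<subseteq> ?W")
    case True
    with WU dimW have n: "p = dim U - dim V" by (metis diff_add_inverse subset_antisym)
    have "rel_basis U V p x"
      unfolding rel_basis_def
    proof (intro conjI ballI)
      fix u assume "u \<in> U"
      then obtain v c where "v \<in> V" "u = v + lincomb p x c"
        using True unfolding span_eq_lincombs by (auto elim!: set_plus_elim dest!: subsetD)
      then have "u - lincomb p x c \<in> V" by simp
      then show "\<exists>c. u - lincomb p x c \<in> V" by blast
    qed (use less.prems P in auto)
    then show ?thesis unfolding n[symmetric] using less.prems by blast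
  next
    case False
    then obtain u where u: "u \<in> U" "u \<notin> ?W" by blast
    \<comment> \<open>Since \<open>?W\<close> contains \<open>V\<close> and is closed under adding
      it, exchanging \<open>u\<close> for a representative of the same coset keeps it outside
      \<open>?W\<close>.\<close>
    obtain q where q: "q \<in> P" "u - q \<in> V" using PU u by blast
    have "q \<notin> ?W"
    proof
      assume "q \<in> ?W"
      then obtain v w where "v \<in> V" "w \<in> span (x ` {1..p})" "q = v + w" by (auto elim: set_plus_elim)
      then have "u = (u - q + v) + w" by simp
      moreover have "u - q + v \<in> V" using q V \<open>v \<in> V\<close> by (intro subspace_add)
      ultimately show False using u \<open>w \<in> _\<close> set_plus_intro by metis
    qed
    then have ind: "rel_indep V (Suc p) (x(Suc p := q))" using rel_indep_Suc V less.prems by blast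
    have mem: "(x(Suc p := q)) i \<in> P" if "i \<in> {1..Suc p}" for i
      using that q less.prems(1)[of i] by (cases "i = Suc p") auto
    have "q \<in> U" using q P by blast
    have "insert q ?W \<subseteq> U" using WU \<open>q \<in> U\<close> by blast
    moreover have "dim (insert q ?W) = Suc (dim ?W)"
      using \<open>q \<notin> ?W\<close> V subspace_sum_sets by (simp add: dim_insert span_eq_iff[THEN iffD2])
    ultimately have "Suc p \<le> dim U - dim V" using dimW dim_subset by (metis Suc_leI add_Suc_right le_diff_conv2 add.commute dim_subset V(2))
    then have "dim U - dim V - Suc p < dim U - dim V - p" by linarith
    from less.hyps[OF this mem ind] obtain y where
      y: "rel_basis U V (dim U - dim V) y" "\<forall>i\<in>{1..Suc p}. y i = (x(Suc p := q)) i"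
        "\<forall>i\<in>{1..dim U - dim V}. y i \<in> P" by blast
    have "\<forall>i\<in>{1..p}. y i = x i" using y(2) by auto
    then show ?thesis using y le by blast
  qed
qed

section \<open>Quotient spaces in terms of representatives\<close>

lemma coset_eq_iff:
  assumes "subspace V"
  shows "a +o V = b +o V \<longleftrightarrow> a - b \<in> V"
proof
  assume "a +o V = b +o V"
  then have "a \<in> b +o V" using assms set_plus_intro2[of 0 V a] subspace_0 by auto
  then show "a - b \<in> V" by (rule set_plus_imp_minus)
next
  assume ab: "a - b \<in> V"
  have "a +o V = b +o ((a - b) +o V)" by (simp add: set_plus_rearrange2)
  also have "(a - b) +o V = V"
  proof
    show "(a - b) +o V \<subseteq> V" using ab assms by (auto simp: elt_set_plus_def intro: subspace_add)
    show "V \<subseteq> (a - b) +o V"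
    proof
      fix v assume "v \<in> V"
      then have "v - (a - b) \<in> V" using ab assms subspace_diff by blast
      then show "v \<in> (a - b) +o V" unfolding elt_set_plus_def by force
    qed
  qed
  finally show "a +o V = b +o V" .
qed

lemma subspace_plus_self: "subspace V \<Longrightarrow> V + V = V"
  by (auto elim!: set_plus_elim intro: subspace_add)
    (metis add_0 set_plus_intro subspace_0)

lemma coset_lincomb_eq:
  assumes V: "subspace V"
  shows "coset_lincomb s V n c (\<lambda>i. x i +o V) = lincomb n x c +o V"
proof -
  have sc: "coset_scale s V a (y +o V) = s a y +o V" for a y
  proof -
    have "s a ` V + V = V"
      using V by (auto elim!: set_plus_elim intro!: subspace_add subspace_scale)
        (metis add_0 image_eqI scale_zero_right set_plus_intro subspace_0)
    moreover have "s a ` (y +o V) = s a y +o (s a ` V)"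
      unfolding elt_set_plus_def by (auto simp: scale_right_distrib image_iff) (metis scale_right_distrib)
    ultimately show ?thesis unfolding coset_scale_def by (simp add: set_plus_rearrange3)
  qed
  show ?thesis unfolding coset_lincomb_def sc
  proof (induction n)
    case (Suc n)
    have "(\<Sum>i\<in>{1..Suc n}. s (c i) (x i) +o V) + V
      = (s (c (Suc n)) (x (Suc n)) +o V) + ((\<Sum>i\<in>{1..n}. s (c i) (x i) +o V) + V)"
      by (simp add: ac_simps)
    also have "\<dots> = lincomb (Suc n) x c +o V"
      unfolding Suc.IH set_plus_rearrange subspace_plus_self[OF V] lincomb_Suc by (simp add: add.commute)
    finally show ?case .
  qed (use V in simp)
qed

lemma quotient_basis_iff:
  assumes U: "subspace U" and V: "subspace V" and xU: "\<And>i. i \<in> {1..n} \<Longrightarrow> x i \<in> U"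
  shows "quotient_basis s U V n (\<lambda>i. x i +o V) \<longleftrightarrow> rel_basis U V n x"
proof -
  have "lincomb n x c +o V = V \<longleftrightarrow> lincomb n x c \<in> V" for c
    using coset_eq_iff[OF V, of "lincomb n x c" 0] by simp
  then show ?thesis
    using xU unfolding quotient_basis_def rel_basis_def rel_indep_def coset_lincomb_eq[OF V]
    by (auto simp: quotient_space_def coset_eq_iff[OF V])
qed

text \<open>The \<open>THE\<close> in the definition needs existence and uniqueness of the length of
  a basis. Existence comes from extending the empty family, uniqueness from
  \<open>rel_basis_dim\<close> after representatives have been chosen.\<close>

lemma quotient_dim_eq:
  assumes U: "subspace U" and V: "subspace V" "V \<subseteq> U"
  shows "quotient_dim s U V = dim U - dim V"
  unfolding quotient_dim_def
proof (rule the_equality)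
  have "rel_indep V 0 (\<lambda>_. 0)" by (simp add: rel_indep_def)
  then obtain y where y: "rel_basis U V (dim U - dim V) y"
    using rel_basis_extend[OF U V, of U 0 "\<lambda>_. 0"] V by (auto simp: subspace_0) (metis diff_self subspace_0)
  then have "quotient_basis s U V (dim U - dim V) (\<lambda>i. y i +o V)"
    using U V by (subst quotient_basis_iff) (auto simp: rel_basis_def)
  then show "\<exists>b. quotient_basis s U V (dim U - dim V) b" by blast
next
  fix n assume "\<exists>b. quotient_basis s U V n b"
  then obtain b where b: "quotient_basis s U V n b" by blast
  then have "\<forall>i\<in>{1..n}. \<exists>x\<in>U. b i = x +o V"
    unfolding quotient_basis_def quotient_space_def by blast
  then obtain x where x: "\<forall>i\<in>{1..n}. x i \<in> U \<and> b i = x i +o V" by metis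
  have "coset_lincomb s V n c b = coset_lincomb s V n c (\<lambda>i. x i +o V)" for c
    unfolding coset_lincomb_def using x by (intro arg_cong2[where f = "(+)"] sum.cong refl) auto
  then have "quotient_basis s U V n (\<lambda>i. x i +o V)" using b x unfolding quotient_basis_def by auto
  then have "rel_basis U V n x" using x U V by (subst (asm) quotient_basis_iff) auto
  then show "n = dim U - dim V" using rel_basis_dim U V by blast
qed

text \<open>Lifted bases of the successive quotients of a filtration span a complement of the bottom
  space in the top one. A vector is reduced from the top level downwards; if a combination lies in
  \<open>U 0\<close>, its coefficients vanish at the top level, then at the next one, and so on.
  This turns systems into direct complements of \<open>R_c\<close> and \<open>R_r\<close>.\<close>

lemma span_rel_bases:
  fixes U :: "nat \<Rightarrow> 'v set"
  assumes sub: "\<And>k. k \<le> n \<Longrightarrow> subspace (U k)"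
    and mono: "\<And>k. k \<in> {1..n} \<Longrightarrow> U (k - 1) \<subseteq> U k"
    and b: "\<And>k. k \<in> {1..n} \<Longrightarrow> rel_basis (U k) (U (k - 1)) (d k) (x k)"
  shows "U n = span {x k i | k i. k \<in> {1..n} \<and> i \<in> {1..d k}} + U 0 \<and>
    span {x k i | k i. k \<in> {1..n} \<and> i \<in> {1..d k}} \<inter> U 0 \<subseteq> {0}"
  using assms
proof (induction n)
  case 0
  then show ?case by simp
next
  case (Suc n)
  let ?X = "\<lambda>n. {x k i | k i. k \<in> {1..n} \<and> i \<in> {1..d k}}"
  have IH: "U n = span (?X n) + U 0" "span (?X n) \<inter> U 0 \<subseteq> {0}"
    using Suc by (auto simp: Suc.prems)
  have b: "rel_basis (U (Suc n)) (U n) (d (Suc n)) (x (Suc n))" using Suc.prems(3)[of "Suc n"] by simp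
  have "?X (Suc n) = ?X n \<union> x (Suc n) ` {1..d (Suc n)}"
    by (auto simp: le_Suc_eq) fastforce
  then have sp: "span (?X (Suc n)) = span (?X n) + range (lincomb (d (Suc n)) (x (Suc n)))"
    unfolding span_eq_lincombs[symmetric] by (simp only: span_Un) (auto simp: set_plus_def)
  have s0: "subspace (U 0)" and sn: "subspace (U n)" and sS: "subspace (U (Suc n))" 
    using Suc.prems(1) by auto
  have Un: "U n \<subseteq> U (Suc n)" using Suc.prems(2)[of "Suc n"] by simp
  have Xn: "span (?X n) \<subseteq> U n" unfolding IH(1) using s0
    by (metis (no_types, lifting) add_0_right set_plus_intro subsetI subspace_0)
  show ?case
  proof
    show "U (Suc n) = span (?X (Suc n)) + U 0"
    proof
      show "U (Suc n) \<subseteq> span (?X (Suc n)) + U 0"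
      proof
        fix u assume "u \<in> U (Suc n)"
        then obtain c where "u - lincomb (d (Suc n)) (x (Suc n)) c \<in> U n"
          using b unfolding rel_basis_def by blast
        then have "(u - lincomb (d (Suc n)) (x (Suc n)) c) + lincomb (d (Suc n)) (x (Suc n)) c
            \<in> span (?X n) + U 0 + range (lincomb (d (Suc n)) (x (Suc n)))"
          unfolding IH(1)[symmetric] by (intro set_plus_intro rangeI)
        then have "u \<in> span (?X n) + U 0 + range (lincomb (d (Suc n)) (x (Suc n)))" by simp
        then show "u \<in> span (?X (Suc n)) + U 0" unfolding sp by (simp add: ac_simps)
      qed
      have "range (lincomb (d (Suc n)) (x (Suc n))) \<subseteq> U (Suc n)"
        using b sS unfolding rel_basis_def by (auto intro!: lincomb_mem)
      then have "span (?X n) + U 0 + range (lincomb (d (Suc n)) (x (Suc n))) \<subseteq> U (Suc n)"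
        using Un sS unfolding IH(1)[symmetric] by (auto elim!: set_plus_elim intro: subspace_add)
      then show "span (?X (Suc n)) + U 0 \<subseteq> U (Suc n)" unfolding sp by (simp add: ac_simps)
    qed
    show "span (?X (Suc n)) \<inter> U 0 \<subseteq> {0}"
    proof
      fix u assume "u \<in> span (?X (Suc n)) \<inter> U 0"
      then obtain a c where u: "u \<in> U 0" "a \<in> span (?X n)" "u = a + lincomb (d (Suc n)) (x (Suc n)) c"
        unfolding sp by (auto elim!: set_plus_elim)
      have "0 + u \<in> U n" unfolding IH(1) by (intro set_plus_intro span_zero u(1))
      then have "u \<in> U n" by simp
      then have "lincomb (d (Suc n)) (x (Suc n)) c \<in> U n"
        using u Xn subspace_diff[OF sn, of u a] by auto
      then have "\<forall>i\<in>{1..d (Suc n)}. c i = 0" using b unfolding rel_basis_def rel_indep_def by blast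
      then have "lincomb (d (Suc n)) (x (Suc n)) c = 0" unfolding lincomb_def by (auto intro: sum.neutral)
      then show "u \<in> {0}" using u IH(2) by auto
    qed
  qed
qed

section \<open>Linear relations and their root spaces\<close>

text \<open>The closure conditions are spelled out for pairs, so that they serve as rules on
  \<open>(x, y) \<in> A\<close> without the product module; \<open>linear_relation_in_iff\<close>
  gives the link.\<close>

definition lin_rel :: "('v \<times> 'v) set \<Rightarrow> bool" where
  "lin_rel A \<longleftrightarrow> (0, 0) \<in> A \<and>
     (\<forall>x y x' y'. (x, y) \<in> A \<longrightarrow> (x', y') \<in> A \<longrightarrow> (x + x', y + y') \<in> A) \<and>
     (\<forall>c x y. (x, y) \<in> A \<longrightarrow> (s c x, s c y) \<in> A)"

lemma lin_relI:
  assumes "(0, 0) \<in> A" "\<And>x y x' y'. (x, y) \<in> A \<Longrightarrow> (x', y') \<in> A \<Longrightarrow> (x + x', y + y') \<in> A"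
    "\<And>c x y. (x, y) \<in> A \<Longrightarrow> (s c x, s c y) \<in> A"
  shows "lin_rel A"
  using assms unfolding lin_rel_def by blast

lemma lin_rel_0: "lin_rel A \<Longrightarrow> (0, 0) \<in> A"
  and lin_rel_add: "lin_rel A \<Longrightarrow> (x, y) \<in> A \<Longrightarrow> (x', y') \<in> A \<Longrightarrow> (x + x', y + y') \<in> A"
  and lin_rel_scale: "lin_rel A \<Longrightarrow> (x, y) \<in> A \<Longrightarrow> (s c x, s c y) \<in> A"
  unfolding lin_rel_def by blast+

lemma lin_rel_diff: "lin_rel A \<Longrightarrow> (x, y) \<in> A \<Longrightarrow> (x', y') \<in> A \<Longrightarrow> (x - x', y - y') \<in> A"
  using lin_rel_add[of A x y "s (- 1) x'" "s (- 1) y'"] lin_rel_scale[of A x' y' "- 1"]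
  by (simp add: scale_minus_left)

lemma lin_rel_sum:
  "lin_rel A \<Longrightarrow> (\<And>i. i \<in> I \<Longrightarrow> (f i, g i) \<in> A) \<Longrightarrow> (\<Sum>i\<in>I. s (c i) (f i), \<Sum>i\<in>I. s (c i) (g i)) \<in> A"
  by (induction I rule: infinite_finite_induct) (auto simp: lin_rel_0 intro: lin_rel_add lin_rel_scale)

lemma lin_rel_lincomb:
  "lin_rel A \<Longrightarrow> (\<And>i. i \<in> {1..n} \<Longrightarrow> (x i, y i) \<in> A) \<Longrightarrow> (lincomb n x c, lincomb n y c) \<in> A"
  unfolding lincomb_def by (rule lin_rel_sum)

lemma linear_relation_in_iff: "linear_relation_in s X A \<longleftrightarrow> lin_rel A \<and> A \<subseteq> X \<times> X"
proof -
  interpret p: vector_space_prod s s by unfold_locales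
  have "p.p.subspace A \<longleftrightarrow> lin_rel A"
    unfolding p.p.subspace_def lin_rel_def by (simp add: p.scale_prod zero_prod_def split_paired_Ball_Sigma Ball_def)
  then show ?thesis by (simp add: linear_relation_in_def)
qed

lemma lin_rel_UNIV: "lin_rel UNIV"
  by (simp add: lin_rel_def)

lemma lin_rel_converse: "lin_rel A \<Longrightarrow> lin_rel (A\<inverse>)"
  by (simp add: lin_rel_def)

lemma lin_rel_relcomp: "lin_rel A \<Longrightarrow> lin_rel B \<Longrightarrow> lin_rel (A O B)"
  by (rule lin_relI) (blast intro: lin_rel_0 lin_rel_add lin_rel_scale)+

lemma lin_rel_relpow: "lin_rel A \<Longrightarrow> lin_rel (A ^^ k)"
proof (induction k)
  case 0
  then show ?case by (simp add: lin_rel_def)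
qed (simp add: lin_rel_relcomp)

lemma lin_rel_restriction: "lin_rel A \<Longrightarrow> subspace X \<Longrightarrow> lin_rel (graph_restriction A X)"
  unfolding graph_restriction_def
  by (rule lin_relI) (auto intro: lin_rel_0 lin_rel_add lin_rel_scale subspace_0 subspace_add subspace_scale)

lemma subspace_Domain: "lin_rel A \<Longrightarrow> subspace (Domain A)"
  by (rule subspaceI) (blast intro: lin_rel_0 lin_rel_add lin_rel_scale)+

lemma subspace_Range: "lin_rel A \<Longrightarrow> subspace (Range A)"
  by (rule subspaceI) (blast intro: lin_rel_0 lin_rel_add lin_rel_scale)+

lemma mem_rel_minus: "(x, y) \<in> rel_minus s A c \<longleftrightarrow> (x, y + s c x) \<in> A"
  unfolding rel_minus_def by (auto simp: algebra_simps)

lemma lin_rel_minus: "lin_rel A \<Longrightarrow> lin_rel (rel_minus s A c)"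
proof (rule lin_relI, goal_cases)
  case (2 x y x' y')
  then show ?case using lin_rel_add[of A x "y + s c x" x' "y' + s c x'"]
    by (simp add: mem_rel_minus scale_right_distrib ac_simps)
next
  case (3 k x y)
  then show ?case using lin_rel_scale[of A x "y + s c x" k]
    by (simp add: mem_rel_minus scale_right_distrib mult.commute)
qed (simp add: mem_rel_minus lin_rel_0)

lemma rel_minus_0 [simp]: "rel_minus s A 0 = A"
  by (auto simp: mem_rel_minus)

lemma rel_minus_rel_minus: "rel_minus s (rel_minus s A c) d = rel_minus s A (c + d)"
  by (auto simp: mem_rel_minus scale_left_distrib ac_simps)

section \<open>Root spaces as sets of chains\<close>

lemma relpow_converse: "((A :: ('v \<times> 'v) set) ^^ k)\<inverse> = (A\<inverse>) ^^ k"
proof (induction k)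
  case (Suc k)
  have "(A ^^ Suc k)\<inverse> = A\<inverse> O (A\<inverse>) ^^ k" by (simp add: converse_relcomp Suc)
  then show ?case by (simp add: relpow_commute)
qed auto

lemma rel_mul_relpow: "rel_mul ((A :: ('v \<times> 'v) set) ^^ k) = rel_ker ((A\<inverse>) ^^ k)"
  unfolding rel_mul_def rel_ker_def relpow_converse[symmetric] by simp

text \<open>The reflexive transitive closure collects the kernels of all powers at once and provides
  induction along a chain without an exponent. \<open>nul (rel_minus s A c)\<close> is the root
  space at \<open>c\<close>, and \<open>nul (A\<inverse>)\<close> is the one at infinity, as
  \<open>mul\<close> of a power is the kernel of the power of the inverse.\<close>

definition nul :: "('v \<times> 'v) set \<Rightarrow> 'v set" where
  "nul B = {x. (x, 0) \<in> B\<^sup>*}"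

lemma nul_0 [simp]: "0 \<in> nul B"
  by (simp add: nul_def)

lemma nul_step: "(x, y) \<in> B \<Longrightarrow> y \<in> nul B \<Longrightarrow> x \<in> nul B"
  unfolding nul_def by (auto intro: converse_rtrancl_into_rtrancl)

lemma nul_induct [consumes 1, case_names zero step]:
  assumes "x \<in> nul B" "P 0" "\<And>x y. (x, y) \<in> B \<Longrightarrow> y \<in> nul B \<Longrightarrow> P y \<Longrightarrow> P x"
  shows "P x"
proof -
  have "(x, 0) \<in> B\<^sup>*" using assms(1) by (simp add: nul_def)
  then show ?thesis
    by (induction rule: converse_rtrancl_induct) (use assms(2,3) in \<open>auto simp: nul_def\<close>)
qed

lemma nul_image: "lin_rel B \<Longrightarrow> x \<in> nul B \<Longrightarrow> \<exists>y\<in>nul B. (x, y) \<in> B"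
  by (erule nul_induct) (auto intro: lin_rel_0)

text \<open>Two chains of different lengths are added by stepping along both at once; since
  \<open>(0, 0) \<in> B\<close>, a chain that has reached 0 goes on with 0.\<close>

lemma subspace_nul:
  assumes B: "lin_rel B"
  shows "subspace (nul B)"
proof (rule subspaceI)
  fix x y assume x: "x \<in> nul B" and y: "y \<in> nul B"
  from x have "\<forall>y\<in>nul B. x + y \<in> nul B"
  proof (induction rule: nul_induct)
    case (step x x')
    then show ?case using nul_image[OF B] lin_rel_add[OF B] nul_step by blast
  qed simp
  then show "x + y \<in> nul B" using y by blast
next
  fix c x assume "x \<in> nul B"
  then show "s c x \<in> nul B"
    by (induction rule: nul_induct) (auto intro: nul_step lin_rel_scale[OF B])
qed simp

lemma rel_ker_relpow_0: "rel_ker (B ^^ 0) = {0}"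
  by (auto simp: rel_ker_def)

lemma rel_ker_relpow_Suc: "x \<in> rel_ker (B ^^ Suc k) \<longleftrightarrow> (\<exists>y\<in>rel_ker (B ^^ k). (x, y) \<in> B)"
  unfolding rel_ker_def by (auto simp del: relpow.simps intro: relpow_Suc_I2 dest: relpow_Suc_D2)

lemma subspace_rel_ker: "lin_rel B \<Longrightarrow> subspace (rel_ker B)"
  unfolding rel_ker_def
  by (rule subspaceI)
    (auto intro: lin_rel_0 dest: lin_rel_add[of B _ 0 _ 0] lin_rel_scale[of B _ 0])

lemma subspace_rel_ker_relpow: "lin_rel B \<Longrightarrow> subspace (rel_ker (B ^^ k))"
  by (simp add: subspace_rel_ker lin_rel_relpow)

lemma rel_ker_relpow_mono: "lin_rel B \<Longrightarrow> rel_ker (B ^^ k) \<subseteq> rel_ker (B ^^ Suc k)"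
proof (induction k)
  case 0
  then show ?case using lin_rel_0 by (auto simp: rel_ker_def)
next
  case (Suc k)
  show ?case
  proof
    fix x assume "x \<in> rel_ker (B ^^ Suc k)"
    then obtain y where "y \<in> rel_ker (B ^^ k)" "(x, y) \<in> B" unfolding rel_ker_relpow_Suc by blast
    then show "x \<in> rel_ker (B ^^ Suc (Suc k))"
      using Suc unfolding rel_ker_relpow_Suc[of x "Suc k"] by blast
  qed
qed

lemma nul_eq_UN: "nul B = (\<Union>k. rel_ker (B ^^ k))"
  unfolding nul_def rel_ker_def rtrancl_is_UN_relpow by auto

lemma span_kernels:
  assumes B: "lin_rel B"
  shows "span (\<Union>i\<in>{1..}. rel_ker (B ^^ i)) = nul B"
proof
  show "span (\<Union>i\<in>{1..}. rel_ker (B ^^ i)) \<subseteq> nul B"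
    by (rule span_minimal) (auto simp: nul_eq_UN subspace_nul[OF B, unfolded nul_eq_UN])
  have "rel_ker (B ^^ k) \<subseteq> (\<Union>i\<in>{1..}. rel_ker (B ^^ i))" for k
    using rel_ker_relpow_mono[OF B, of k] by fastforce
  then show "nul B \<subseteq> span (\<Union>i\<in>{1..}. rel_ker (B ^^ i))"
    unfolding nul_eq_UN by (meson UN_least span_superset subset_trans)
qed

lemma root_space_Fin: "lin_rel A \<Longrightarrow> root_space s A (Fin c) = nul (rel_minus s A c)"
  unfolding root_space.simps by (intro span_kernels lin_rel_minus)

lemma root_space_Infty: "lin_rel A \<Longrightarrow> root_space s A Infty = nul (A\<inverse>)"
  unfolding root_space.simps rel_mul_relpow by (intro span_kernels lin_rel_converse)

text \<open>A vector belongs to this space exactly if it lies on a chain of \<open>A\<close> from 0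
  back to 0, a singular chain. It is \<open>singular_chain_space\<close> for linear relations, in a
  form symmetric in \<open>A\<close> and its inverse.\<close>

definition Rc :: "('v \<times> 'v) set \<Rightarrow> 'v set" where
  "Rc A = nul A \<inter> nul (A\<inverse>)"

lemma singular_chain_space_eq: "lin_rel A \<Longrightarrow> singular_chain_space s A = Rc A"
  by (simp only: singular_chain_space_def root_space_Fin root_space_Infty rel_minus_0 Rc_def)

lemma subspace_Rc: "lin_rel A \<Longrightarrow> subspace (Rc A)"
  unfolding Rc_def by (simp add: subspace_inter subspace_nul lin_rel_converse)

lemma Rc_converse [simp]: "Rc (A\<inverse>) = Rc A"
  by (auto simp: Rc_def)

lemma Rc_image: "lin_rel A \<Longrightarrow> x \<in> Rc A \<Longrightarrow> \<exists>y\<in>Rc A. (x, y) \<in> A"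
  unfolding Rc_def using nul_image[of A x] nul_step[of _ x "A\<inverse>"] by blast

lemma Rc_preimage: "lin_rel A \<Longrightarrow> y \<in> Rc A \<Longrightarrow> \<exists>x\<in>Rc A. (x, y) \<in> A"
  using Rc_image[OF lin_rel_converse, of A y] by auto

text \<open>If \<open>(y, x)\<close> lies in \<open>A - c\<close>, then \<open>(y, x + c y)\<close>
  lies in \<open>A\<close>; with \<open>y\<close> in the root space at infinity, so is
  \<open>x + c y\<close>, and hence \<open>x\<close>. The other inclusion is the same one for
  \<open>A - c\<close> and the shift \<open>- c\<close>.\<close>

lemma nul_converse_rel_minus:
  assumes A: "lin_rel A"
  shows "nul ((rel_minus s A c)\<inverse>) = nul (A\<inverse>)"
proof -
  have *: "nul ((rel_minus s A c)\<inverse>) \<subseteq> nul (A\<inverse>)" if A: "lin_rel A" for A c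
  proof
    fix x assume "x \<in> nul ((rel_minus s A c)\<inverse>)"
    then show "x \<in> nul (A\<inverse>)"
    proof (induction rule: nul_induct)
      case (step x y)
      then have "x + s c y \<in> nul (A\<inverse>)" by (auto simp: mem_rel_minus intro: nul_step)
      then have "x + s c y - s c y \<in> nul (A\<inverse>)"
        using step A by (intro subspace_diff subspace_scale subspace_nul lin_rel_converse)
      then show ?case by simp
    qed simp
  qed
  show ?thesis
    using *[OF A, of c] *[OF lin_rel_minus[OF A, of c], of "- c"] by (auto simp: rel_minus_rel_minus)
qed

text \<open>
  The chain \<open>z\<^sub>j\<^sub>+\<^sub>1 = c z\<^sub>j + x\<^sub>j\<^sub>+\<^sub>1\<close> satisfies \<open>(z\<^sub>j, x\<^sub>j\<^sub>+\<^sub>1) \<in> A - c\<close>, so that its last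
  but one element lies in \<open>T\<close> and the induction hypothesis applies to it.
\<close>

lemma chain_in_preimage_closed:
  assumes A: "lin_rel A" and T: "subspace T" "\<And>x y. (x, y) \<in> A \<Longrightarrow> y - s c x \<in> T \<Longrightarrow> x \<in> T"
    and "x 0 = 0" "\<And>j. j < n \<Longrightarrow> (x j, x (Suc j)) \<in> A" "x n \<in> T" "j \<le> n"
  shows "x j \<in> T"
  using assms(4-)
proof (induction n arbitrary: x j)
  case 0
  then show ?case by simp
next
  case (Suc n)
  define z where "z = rec_nat 0 (\<lambda>j z. s c z + x (Suc j))"
  have z0: "z 0 = 0" and zS: "z (Suc j) = s c (z j) + x (Suc j)" for j by (simp_all add: z_def)
  have chain: "(z j, z (Suc j)) \<in> A" if "j \<le> n" for j
    using that
  proof (induction j)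
    case 0
    then show ?case using Suc.prems(1,2) z0 zS by force
  next
    case (Suc j)
    then have "(s c (z j), s c (z (Suc j))) \<in> A" using lin_rel_scale[OF A] by simp
    moreover have "(x (Suc j), x (Suc (Suc j))) \<in> A" using Suc Suc.prems \<open>\<And>j. j < Suc n \<Longrightarrow> _\<close> by simp
    ultimately show ?case unfolding zS[of "Suc j"] zS[of j] by (rule lin_rel_add[OF A, unfolded zS])
  qed
  have "z n \<in> T" using T(2)[OF chain[of n]] Suc.prems(3) by (simp add: zS)
  then have zT: "z j \<in> T" if "j \<le> n" for j
    using Suc.IH[of z j] z0 chain that by simp
  consider "j = 0" | "j = Suc n" | i where "j = Suc i" "Suc i \<le> n"
    using Suc.prems(4) by (metis le_Suc_eq not0_implies_Suc)
  then show ?case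
  proof cases
    case 3
    then have "z (Suc i) - s c (z i) \<in> T" using zT T(1) by (intro subspace_diff subspace_scale) auto
    then show ?thesis using 3 by (simp add: zS)
  qed (use Suc.prems T(1) subspace_0 in auto)
qed

text \<open>A singular chain of \<open>A\<close> is not a chain of \<open>A - c\<close>, but the
  root space at \<open>c\<close> contains its last vector 0 and is closed under preimages of
  \<open>A - c\<close>. \<open>chain_in_preimage_closed\<close> then puts the whole chain into
  it.\<close>

lemma Rc_subset_nul_rel_minus:
  assumes A: "lin_rel A"
  shows "Rc A \<subseteq> nul (rel_minus s A c)"
proof
  fix x assume "x \<in> Rc A"
  then have "(0, x) \<in> A\<^sup>*" "(x, 0) \<in> A\<^sup>*" by (auto simp: Rc_def nul_def rtrancl_converse)
  then obtain p q where "(0, x) \<in> A ^^ p" "(x, 0) \<in> A ^^ q" using rtrancl_imp_relpow by meson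
  then obtain f g where f: "f 0 = 0" "f p = x" "\<And>i. i < p \<Longrightarrow> (f i, f (Suc i)) \<in> A"
    and g: "g 0 = x" "g q = 0" "\<And>i. i < q \<Longrightarrow> (g i, g (Suc i)) \<in> A"
    unfolding relpow_fun_conv by blast
  \<comment> \<open>The chain from 0 to \<open>x\<close>, followed by the chain from
    \<open>x\<close> to 0; \<open>x\<close> stands at position \<open>p\<close>.\<close>
  define h where "h i = (if i \<le> p then f i else g (i - p))" for i
  have chain: "(h i, h (Suc i)) \<in> A" if "i < p + q" for i
  proof -
    consider "i < p" | "i = p" | "i > p" by linarith
    then show ?thesis
    proof cases
      case 3
      then show ?thesis using g(3)[of "i - p"] that by (simp add: h_def Suc_diff_le)
    qed (use f g(1) g(3)[of 0] that in \<open>auto simp: h_def\<close>)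
  qed
  have end0: "h (p + q) = 0" using f g by (cases q) (auto simp: h_def)
  have "h p \<in> nul (rel_minus s A c)"
  proof (rule chain_in_preimage_closed[OF A, where n = "p + q" and c = c])
    show "subspace (nul (rel_minus s A c))" by (simp add: subspace_nul lin_rel_minus A)
    show "x \<in> nul (rel_minus s A c)" if "(x, y) \<in> A" "y - s c x \<in> nul (rel_minus s A c)" for x y
      using that by (auto intro!: nul_step[of x "y - s c x"] simp: mem_rel_minus)
  qed (use f chain end0 in \<open>auto simp: h_def\<close>)
  then show "x \<in> nul (rel_minus s A c)" using f by (simp add: h_def)
qed

text \<open>One inclusion for all relations and all shifts suffices, because shifting
  \<open>A - c\<close> by \<open>- c\<close> gives \<open>A\<close> back.\<close>

lemma Rc_rel_minus:
  assumes A: "lin_rel A"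
  shows "Rc (rel_minus s A c) = Rc A"
proof -
  have *: "Rc A \<subseteq> Rc (rel_minus s A c)" if A: "lin_rel A" for A c
    using Rc_subset_nul_rel_minus[OF A, of c] nul_converse_rel_minus[OF A, of c] by (auto simp: Rc_def)
  show ?thesis
    using *[OF A, of c] *[OF lin_rel_minus[OF A, of c], of "- c"] by (auto simp: rel_minus_rel_minus)
qed

section \<open>Systems of chains\<close>

text \<open>
  The spaces \<open>F k / G k\<close> are those of the Jordan or shift system at level \<open>k\<close>, and \<open>P k\<close> consists
  of the vectors that start a chain of length \<open>k\<close>. Levels are counted so that chains descend; for
  shift systems \<open>C k\<close> is therefore the inverse relation, and level \<open>k\<close> stands for \<open>k - 1\<close>.
\<close>

lemma chain_system_exists:
  fixes F G P :: "nat \<Rightarrow> 'v set" and C :: "nat \<Rightarrow> ('v \<times> 'v) set"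
  defines "d \<equiv> \<lambda>k. dim (F k) - dim (G k)"
  assumes sub: "\<And>k. k \<in> {1..n} \<Longrightarrow> subspace (F k) \<and> subspace (G k) \<and> G k \<subseteq> F k \<and> P k \<subseteq> F k \<and> lin_rel (C k)"
    and PF: "\<And>k u. k \<in> {1..n} \<Longrightarrow> u \<in> F k \<Longrightarrow> \<exists>p\<in>P k. u - p \<in> G k"
    and step: "\<And>k x. k \<in> {1..n} \<Longrightarrow> x \<in> P k \<Longrightarrow> \<exists>y\<in>P (k - 1). (x, y) \<in> C k"
    and inj: "\<And>k x y. k \<in> {2..n} \<Longrightarrow> (x, y) \<in> C k \<Longrightarrow> x \<in> F k \<Longrightarrow> y \<in> G (k - 1) \<Longrightarrow> x \<in> G k"
    and P0: "P 0 = {0}"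
  shows "\<exists>x. (\<forall>i. x 0 i = 0) \<and> (\<forall>k\<in>{1..n}. (\<forall>i\<in>{1..d k}. (x k i, x (k - 1) i) \<in> C k) \<and>
    rel_basis (F k) (G k) (d k) (x k) \<and> (k > 1 \<longrightarrow> d k \<le> d (k - 1)))"
proof -
  \<comment> \<open>The levels above \<open>m\<close> are filled while \<open>m\<close> runs down
    from \<open>n\<close> to 0. The lowest filled level is not yet linked to the one below it, hence
    the conditions \<open>k > m + 1\<close>.\<close>
  have "\<exists>x. \<forall>k\<in>{m+1..n}. rel_basis (F k) (G k) (d k) (x k) \<and> (k > m + 1 \<longrightarrow> d k \<le> d (k - 1)) \<and>
      (\<forall>i\<in>{1..d k}. x k i \<in> P k \<and> (k > m + 1 \<longrightarrow> (x k i, x (k - 1) i) \<in> C k))"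
    if "m \<le> n" for m
    using that
  proof (induction m rule: inc_induct)
    case base
    show ?case by simp
  next
    case (step m)
    then obtain x where x: "\<And>k. k \<in> {m+2..n} \<Longrightarrow>
        rel_basis (F k) (G k) (d k) (x k) \<and> (k > m + 2 \<longrightarrow> d k \<le> d (k - 1))"
      "\<And>k i. k \<in> {m+2..n} \<Longrightarrow> i \<in> {1..d k} \<Longrightarrow> x k i \<in> P k"
      "\<And>k i. k \<in> {m+2..n} \<Longrightarrow> k > m + 2 \<Longrightarrow> i \<in> {1..d k} \<Longrightarrow> (x k i, x (k - 1) i) \<in> C k"
      by fastforce
    \<comment> \<open>The number of vectors that level \<open>m + 2\<close> hands down; there are
      none when \<open>m + 1\<close> is the top level \<open>n\<close>.\<close>
    define p where "p = (if m + 2 \<le> n then d (m + 2) else 0)"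
    have m1: "m + 1 \<in> {1..n}" using step.hyps by auto
    have "\<forall>i\<in>{1..p}. \<exists>y\<in>P (m + 1). (x (m + 2) i, y) \<in> C (m + 2)"
    proof
      fix i assume "i \<in> {1..p}"
      then have "m + 2 \<in> {m+2..n}" "i \<in> {1..d (m + 2)}" by (auto simp: p_def split: if_splits)
      then show "\<exists>y\<in>P (m + 1). (x (m + 2) i, y) \<in> C (m + 2)"
        using x(2) \<open>\<And>k x. k \<in> {1..n} \<Longrightarrow> x \<in> P k \<Longrightarrow> _\<close>[of "m + 2" "x (m + 2) i"] by simp
    qed
    then obtain y where y: "\<And>i. i \<in> {1..p} \<Longrightarrow> y i \<in> P (m + 1) \<and> (x (m + 2) i, y i) \<in> C (m + 2)"
      by metis
    \<comment> \<open>\<open>C (m + 2)\<close> induces an injection of quotients in the sense of the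
      assumption \<open>inj\<close>: a combination of the images in \<open>G (m + 1)\<close> forces
      the same combination at level \<open>m + 2\<close> into \<open>G (m + 2)\<close>.\<close>
    have "rel_indep (G (m + 1)) p y"
      unfolding rel_indep_def
    proof (intro allI impI)
      fix c assume c: "lincomb p y c \<in> G (m + 1)"
      show "\<forall>i\<in>{1..p}. c i = 0"
      proof (cases "p = 0")
        case False
        then have p: "p = d (m + 2)" "m + 2 \<le> n" by (auto simp: p_def split: if_splits)
        then have m2: "m + 2 \<in> {m+2..n}" "m + 2 \<in> {2..n}" "m + 2 \<in> {1..n}" by auto
        have "(lincomb p (x (m + 2)) c, lincomb p y c) \<in> C (m + 2)"
          using y sub[OF m2(3)] by (intro lin_rel_lincomb) auto
        moreover have "lincomb p (x (m + 2)) c \<in> F (m + 2)"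
          using sub[OF m2(3)] x(2)[OF m2(1)] p by (intro lincomb_mem) auto
        ultimately have "lincomb p (x (m + 2)) c \<in> G (m + 2)" using inj[OF m2(2)] c by simp
        then show ?thesis using x(1)[OF m2(1)] p unfolding rel_basis_def rel_indep_def by blast
      qed simp
    qed
    then have "p \<le> d (m + 1) \<and> (\<exists>z. rel_basis (F (m + 1)) (G (m + 1)) (d (m + 1)) z \<and>
        (\<forall>i\<in>{1..p}. z i = y i) \<and> (\<forall>i\<in>{1..d (m + 1)}. z i \<in> P (m + 1)))"
      unfolding d_def using sub[OF m1] PF[OF m1] y by (intro rel_basis_extend) auto
    then obtain z where z: "rel_basis (F (m + 1)) (G (m + 1)) (d (m + 1)) z" "p \<le> d (m + 1)"
      "\<forall>i\<in>{1..p}. z i = y i" "\<forall>i\<in>{1..d (m + 1)}. z i \<in> P (m + 1)" by blast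
    have "\<forall>k\<in>{m+1..n}. rel_basis (F k) (G k) (d k) ((x(m + 1 := z)) k) \<and>
        (k > m + 1 \<longrightarrow> d k \<le> d (k - 1)) \<and>
      (\<forall>i\<in>{1..d k}. (x(m + 1 := z)) k i \<in> P k \<and>
        (k > m + 1 \<longrightarrow> ((x(m + 1 := z)) k i, (x(m + 1 := z)) (k - 1) i) \<in> C k))"
    proof
      fix k assume k: "k \<in> {m+1..n}"
      consider "k = m + 1" | "k = m + 2" | "k > m + 2" using k by fastforce
      then show "rel_basis (F k) (G k) (d k) ((x(m + 1 := z)) k) \<and>
        (k > m + 1 \<longrightarrow> d k \<le> d (k - 1)) \<and>
        (\<forall>i\<in>{1..d k}. (x(m + 1 := z)) k i \<in> P k \<and>
        (k > m + 1 \<longrightarrow> ((x(m + 1 := z)) k i, (x(m + 1 := z)) (k - 1) i) \<in> C k))"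
      proof cases
        case 1
        then show ?thesis using z by simp
      next
        case 2
        then have "p = d k" using k by (simp add: p_def)
        then show ?thesis using x(1,2)[of k] k y z(2,3) 2 by auto
      next
        case 3
        then have "k - 1 \<noteq> m + 1" "k \<noteq> m + 1" "k \<in> {m+2..n}" using k by auto
        then show ?thesis using x[of k] 3 by auto
      qed
    qed
    then show ?case by blast
  qed
  from this[of 0] obtain x where x: "\<forall>k\<in>{1..n}. rel_basis (F k) (G k) (d k) (x k) \<and>
      (k > 1 \<longrightarrow> d k \<le> d (k - 1)) \<and>
      (\<forall>i\<in>{1..d k}. x k i \<in> P k \<and> (k > 1 \<longrightarrow> (x k i, x (k - 1) i) \<in> C k))" by auto
  \<comment> \<open>Level 0 is set to zero. The link from level 1 holds because its vectors lie in
    \<open>P 1\<close> and \<open>P 0 = {0}\<close>.\<close>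
  have "\<forall>k\<in>{1..n}. (\<forall>i\<in>{1..d k}. ((x(0 := \<lambda>_. 0)) k i, (x(0 := \<lambda>_. 0)) (k - 1) i) \<in> C k) \<and>
    rel_basis (F k) (G k) (d k) ((x(0 := \<lambda>_. 0)) k) \<and> (k > 1 \<longrightarrow> d k \<le> d (k - 1))"
  proof
    fix k assume k: "k \<in> {1..n}"
    show "(\<forall>i\<in>{1..d k}. ((x(0 := \<lambda>_. 0)) k i, (x(0 := \<lambda>_. 0)) (k - 1) i) \<in> C k) \<and>
      rel_basis (F k) (G k) (d k) ((x(0 := \<lambda>_. 0)) k) \<and> (k > 1 \<longrightarrow> d k \<le> d (k - 1))"
    proof (cases "k = 1")
      case True
      then show ?thesis using x step[of 1] P0 k by fastforce
    qed (use k x in auto)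
  qed
  then show ?thesis by (metis fun_upd_same)
qed

section \<open>Jordan systems\<close>

lemma ascending_chain_stabilizes:
  assumes sub: "\<And>k. subspace (U k)" and mono: "\<And>k. U k \<subseteq> U (Suc k)"
  shows "\<exists>k\<ge>1. U (k + 1) = U k"
proof (rule ccontr)
  assume ne: "\<not> ?thesis"
  have "k \<le> dim (U (Suc k))" for k
  proof (induction k)
    case (Suc k)
    have "U (Suc k) \<subset> U (Suc (Suc k))" using ne mono[of "Suc k"] by force
    then have "dim (U (Suc k)) < dim (U (Suc (Suc k)))"
      using sub by (intro dim_psubset) (metis span_eq_iff)
    then show ?case using Suc by linarith
  qed simp
  from this[of "Suc (card Basis)"] show False
    using dim_subset[of "U (Suc (Suc (card Basis)))" UNIV] by simp
qed

text \<open>Only the propagation of equality enters, not the direction of inclusion, so that the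
  descending spaces of shift systems are covered too.\<close>

lemma ascending_chain_constant:
  assumes "U (Suc n) = U n" "\<And>k. U (Suc k) = U k \<Longrightarrow> U (Suc (Suc k)) = U (Suc k)" "n \<le> k"
  shows "U k = U n"
proof -
  have "U (Suc (n + j)) = U (n + j)" for j
    by (induction j) (use assms in auto)
  then have "U (n + j) = U n" for j by (induction j) auto
  then show ?thesis using assms(3) le_Suc_ex by blast
qed

text \<open>The part of \<open>y\<close> in \<open>Rc B\<close> has a preimage in
  \<open>Rc B\<close>, and subtracting it leaves a preimage of a kernel vector. This gives both the
  injectivity between levels and the persistence of an equality of two levels.\<close>

lemma kernel_preimage:
  assumes B: "lin_rel B" and xy: "(x, y) \<in> B" "y \<in> rel_ker (B ^^ k) + Rc B"
  shows "x \<in> rel_ker (B ^^ Suc k) + Rc B"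
proof -
  obtain a b where ab: "a \<in> rel_ker (B ^^ k)" "b \<in> Rc B" "y = a + b"
    using xy by (auto elim: set_plus_elim)
  obtain b' where b': "b' \<in> Rc B" "(b', b) \<in> B" using Rc_preimage[OF B ab(2)] by blast
  have "(x - b', a) \<in> B" using lin_rel_diff[OF B xy(1) b'(2)] ab by simp
  then have "x - b' \<in> rel_ker (B ^^ Suc k)" using ab unfolding rel_ker_relpow_Suc by blast
  then have "(x - b') + b' \<in> rel_ker (B ^^ Suc k) + Rc B" using b' by (intro set_plus_intro)
  then show ?thesis by simp
qed

lemma Rc_subset_nul: "Rc A \<subseteq> nul A"
  by (simp add: Rc_def)

text \<open>Besides the complement of \<open>Rc A\<close> in the root space, two properties of the
  span are recorded for the restriction: images under \<open>A - c\<close> inside the span make it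
  defined everywhere, and a kernel vector makes \<open>c\<close> an eigenvalue. No condition is put
  on \<open>c\<close>, so the result also serves the inverse at 0.\<close>

lemma jordan_system_exists:
  assumes A: "lin_rel A"
  shows "\<exists>x. jordan_system s A c x \<and>
    nul (rel_minus s A c) = jordan_system_span s A c x + Rc A \<and>
    jordan_system_span s A c x \<inter> Rc A \<subseteq> {0} \<and>
    (\<forall>u\<in>jordan_system_span s A c x. \<exists>v\<in>jordan_system_span s A c x. (u, v) \<in> rel_minus s A c) \<and>
    (jordan_system_span s A c x \<noteq> {0} \<longrightarrow>
      (\<exists>u\<in>jordan_system_span s A c x. u \<noteq> 0 \<and> (u, 0) \<in> rel_minus s A c))"
proof -
  define B where "B = rel_minus s A c"
  have B: "lin_rel B" using A by (simp add: B_def lin_rel_minus)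
  have Rc: "singular_chain_space s A = Rc B" by (simp add: A B_def singular_chain_space_eq Rc_rel_minus)
  define U where "U k = rel_ker (B ^^ k) + Rc B" for k
  define n where "n = jordan_length s A c"
  define d where "d k = dim (U k) - dim (U (k - 1))" for k
  have kcs: "ker_chain_space s A c k = U k" for k by (simp add: ker_chain_space_def U_def Rc flip: B_def)
  have U: "subspace (U k)" for k
    unfolding U_def by (intro subspace_sum_sets subspace_rel_ker_relpow subspace_Rc B)
  have mono: "U k \<subseteq> U (Suc k)" for k
    unfolding U_def by (intro set_plus_mono2 rel_ker_relpow_mono B) auto
  have mono': "U (k - 1) \<subseteq> U k" for k using mono[of "k - 1"] by (cases k) auto
  have U0: "U 0 = Rc B" by (simp only: U_def rel_ker_relpow_0 set_add_0)
  have RcU: "Rc B \<subseteq> U k" for k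
    unfolding U_def using subspace_0[OF subspace_rel_ker_relpow[OF B, of k]] set_zero_plus2 by auto
  have kerU: "rel_ker (B ^^ k) \<subseteq> U k" for k
    unfolding U_def using set_zero_plus2[of "Rc B" "rel_ker (B ^^ k)"] subspace_0[OF subspace_Rc[OF B]]
    by (simp add: add.commute)
  have wd: "weyr_dim s A c k = d k" for k
    unfolding weyr_dim_def kcs d_def by (intro quotient_dim_eq U mono')
  have n: "1 \<le> n \<and> U (n + 1) = U n"
    unfolding n_def jordan_length_def kcs
    by (rule LeastI_ex) (use ascending_chain_stabilizes[of U, OF U mono] in blast)
  \<comment> \<open>A kernel vector two levels up has an image in \<open>U (Suc k) = U k\<close>,
    and \<open>kernel_preimage\<close> brings it back to \<open>U (Suc k)\<close>.\<close>
  have "U (Suc (Suc k)) = U (Suc k)" if k: "U (Suc k) = U k" for k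
  proof
    show "U (Suc (Suc k)) \<subseteq> U (Suc k)"
    proof -
      have "rel_ker (B ^^ Suc (Suc k)) \<subseteq> U (Suc k)"
      proof
        fix x assume "x \<in> rel_ker (B ^^ Suc (Suc k))"
        then obtain y where "(x, y) \<in> B" "y \<in> rel_ker (B ^^ Suc k)"
          unfolding rel_ker_relpow_Suc[of x "Suc k"] by blast
        then have "y \<in> U k" using kerU k by blast
        then show "x \<in> U (Suc k)" unfolding U_def by (intro kernel_preimage[OF B \<open>(x, y) \<in> B\<close>])
      qed
      then show ?thesis
        unfolding U_def[of "Suc (Suc k)"] using RcU[of "Suc k"] U[of "Suc k"]
        by (auto elim!: set_plus_elim intro: subspace_add)
    qed
  qed (rule mono)
  then have const: "U k = U n" if "n \<le> k" for k
    using ascending_chain_constant[of U n k] n that by simp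
  have Un: "nul B = U n"
  proof
    have "rel_ker (B ^^ k) \<subseteq> U n" for k
    proof (cases "n \<le> k")
      case False
      have "U k \<subseteq> U n" using False lift_Suc_mono_le[of U k n] mono by simp
      then show ?thesis using kerU by blast
    qed (use kerU const in blast)
    then show "nul B \<subseteq> U n" by (auto simp: nul_eq_UN)
    have "rel_ker (B ^^ n) \<subseteq> nul B" by (auto simp: nul_eq_UN)
    then show "U n \<subseteq> nul B"
      unfolding U_def using Rc_subset_nul subspace_nul[OF B] by (auto elim!: set_plus_elim intro: subspace_add)
  qed
  \<comment> \<open>The representatives are taken from the kernels themselves and not only from
    \<open>U k\<close>, so that the chains end exactly in 0 and not merely in
    \<open>Rc B\<close>.\<close>
  have ex: "\<exists>x. (\<forall>i. x 0 i = 0) \<and> (\<forall>k\<in>{1..n}. (\<forall>i\<in>{1..dim (U k) - dim (U (k - 1))}. (x k i, x (k - 1) i) \<in> B) \<and>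
    rel_basis (U k) (U (k - 1)) (dim (U k) - dim (U (k - 1))) (x k) \<and>
    (k > 1 \<longrightarrow> dim (U k) - dim (U (k - 1)) \<le> dim (U (k - 1)) - dim (U (k - 1 - 1))))"
  proof (rule chain_system_exists[where P = "\<lambda>k. rel_ker (B ^^ k)"])
    fix k assume k: "k \<in> {1..n}"
    show "subspace (U k) \<and> subspace (U (k - 1)) \<and> U (k - 1) \<subseteq> U k \<and> rel_ker (B ^^ k) \<subseteq> U k \<and> lin_rel B"
      using U mono' kerU B by blast
    show "\<exists>p\<in>rel_ker (B ^^ k). u - p \<in> U (k - 1)" if "u \<in> U k" for u
      using that RcU[of "k - 1"] unfolding U_def[of k] by (force elim!: set_plus_elim)
    show "\<exists>y\<in>rel_ker (B ^^ (k - 1)). (x, y) \<in> B" if "x \<in> rel_ker (B ^^ k)" for x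
      using that k rel_ker_relpow_Suc[of x "k - 1" B] by auto
  next
    fix k x y assume "k \<in> {2..n}" "(x, y) \<in> B" "y \<in> U (k - 1 - 1)"
    then have "x \<in> U (Suc (k - 1 - 1))" unfolding U_def by (intro kernel_preimage[OF B])
    then show "x \<in> U (k - 1)" using \<open>k \<in> {2..n}\<close> by (simp add: Suc_diff_Suc numeral_2_eq_2)
  qed (rule rel_ker_relpow_0)
  then obtain x where x0: "\<And>i. x 0 i = 0"
    and xB: "\<And>k i. k \<in> {1..n} \<Longrightarrow> i \<in> {1..d k} \<Longrightarrow> (x k i, x (k - 1) i) \<in> B"
    and xb: "\<And>k. k \<in> {1..n} \<Longrightarrow> rel_basis (U k) (U (k - 1)) (d k) (x k)"
    and d: "\<And>k. k \<in> {1..n} \<Longrightarrow> k > 1 \<Longrightarrow> d k \<le> d (k - 1)"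
    unfolding d_def by blast
  have js: "jordan_system s A c x"
    unfolding jordan_system_def wd kcs n_def[symmetric]
  proof (intro conjI allI ballI x0)
    fix k i assume k: "k \<in> {1..n}"
    show "(x k i, x (k - 1) i + s c (x k i)) \<in> A" if "i \<in> {1..d k}"
      using xB[OF k that] by (simp add: B_def mem_rel_minus)
    show "quotient_basis s (U k) (U (k - 1)) (d k) (\<lambda>i. x k i +o U (k - 1))"
      using xb[OF k] by (subst quotient_basis_iff[OF U U]) (auto simp: rel_basis_def)
  qed
  define S where "S = {x k i | k i. k \<in> {1..n} \<and> i \<in> {1..d k}}"
  have span: "jordan_system_span s A c x = span S"
    by (simp only: jordan_system_span_def wd S_def flip: n_def)
  have US: "U n = span S + U 0 \<and> span S \<inter> U 0 \<subseteq> {0}"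
    unfolding S_def by (rule span_rel_bases) (use U mono' xb in auto)
  \<comment> \<open>Since \<open>d\<close> is nonincreasing, the index \<open>i\<close> also occurs
    at level \<open>k - 1\<close>; below level 1 the vector is 0.\<close>
  have xS: "x (k - 1) i \<in> insert 0 S" if "k \<in> {1..n}" "i \<in> {1..d k}" for k i
  proof (cases "k = 1")
    case False
    then have "k - 1 \<in> {1..n}" "i \<in> {1..d (k - 1)}" using that d[of k] by auto
    then show ?thesis unfolding S_def by blast
  qed (simp add: x0)
  have img: "span S \<subseteq> {u. \<exists>v\<in>span S. (u, v) \<in> B}"
  proof (rule span_minimal)
    have *: "insert 0 S \<subseteq> span S" by (simp add: span_zero span_superset)
    show "S \<subseteq> {u. \<exists>v\<in>span S. (u, v) \<in> B}"
    proof
      fix u assume "u \<in> S"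
      then obtain k i where "k \<in> {1..n}" "i \<in> {1..d k}" "u = x k i" unfolding S_def by blast
      then show "u \<in> {u. \<exists>v\<in>span S. (u, v) \<in> B}" using xS xB * by blast
    qed
    show "subspace {u. \<exists>v\<in>span S. (u, v) \<in> B}"
      by (rule subspaceI) (use B in \<open>blast intro: lin_rel_0 lin_rel_add lin_rel_scale span_zero span_add span_scale\<close>)+
  qed
  have ker: "\<exists>u\<in>span S. u \<noteq> 0 \<and> (u, 0) \<in> B" if ne: "span S \<noteq> {0}"
  proof -
    \<comment> \<open>At the lowest level with a nonzero vector the successor of that vector is 0,
      which yields the kernel vector.\<close>
    define Q where "Q k \<longleftrightarrow> k \<in> {1..n} \<and> (\<exists>i\<in>{1..d k}. x k i \<noteq> 0)" for k
    have "\<exists>k. Q k"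
    proof (rule ccontr)
      assume "\<not> ?thesis"
      then have "S \<subseteq> {0}" unfolding S_def Q_def by blast
      then have "span S \<subseteq> {0}" by (intro span_minimal) auto
      then show False using ne span_zero by blast
    qed
    then have Q: "Q (LEAST k. Q k)" by (rule LeastI_ex)
    define k where "k = (LEAST k. Q k)"
    have "Q k" unfolding k_def by (rule Q)
    then obtain i where i: "k \<in> {1..n}" "i \<in> {1..d k}" "x k i \<noteq> 0"
      unfolding Q_def by blast
    have "x (k - 1) i = 0"
    proof (cases "k = 1")
      case False
      then have "\<not> Q (k - 1)" "k - 1 \<in> {1..n}" "i \<in> {1..d (k - 1)}"
        using i d[of k] not_less_Least[of "k - 1" Q] unfolding k_def[symmetric] by auto
      then show ?thesis unfolding Q_def by blast
    qed (simp add: x0)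
    then have "(x k i, 0) \<in> B" using xB i by metis
    moreover have "x k i \<in> span S" using i unfolding S_def by (intro span_base) blast
    ultimately show ?thesis using i by blast
  qed
  have RcA: "Rc A = U 0" unfolding U0 B_def by (simp add: Rc_rel_minus A)
  show ?thesis
  proof (intro exI[of _ x] conjI, unfold span B_def[symmetric])
    show "nul B = span S + Rc A" "span S \<inter> Rc A \<subseteq> {0}" using US Un RcA by auto
    show "\<forall>u\<in>span S. \<exists>v\<in>span S. (u, v) \<in> B" using img by blast
    show "span S \<noteq> {0} \<longrightarrow> (\<exists>u\<in>span S. u \<noteq> 0 \<and> (u, 0) \<in> B)" using ker by blast
  qed (rule js)
qed

section \<open>Independence of the root spaces\<close>

text \<open>This is what single-valuedness modulo \<open>nul (A\<inverse>)\<close> means for every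
  \<open>A - c\<close>: that space is mapped into itself, and in particular it contains all images
  of 0.\<close>

lemma nul_converse_image:
  assumes "lin_rel A" "x \<in> nul (A\<inverse>)" "(x, y) \<in> rel_minus s A c"
  shows "y \<in> nul (A\<inverse>)"
  using assms nul_converse_rel_minus[OF assms(1), of c] nul_step[of y x "(rel_minus s A c)\<inverse>"] by auto

lemma rel_minus_shift: "(x, y) \<in> rel_minus s A c \<Longrightarrow> (x, y + s (c - d) x) \<in> rel_minus s A d"
  by (simp add: mem_rel_minus scale_left_diff_distrib)

lemma nul_cancel_scale: 
  assumes "lin_rel B" "s c x \<in> nul B" "c \<noteq> 0" shows "x \<in> nul B"
  using subspace_scale[OF subspace_nul[OF assms(1)] assms(2), of "inverse c"] assms(3) by simp

lemma nul_inter_nul_converse: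
  assumes "lin_rel A" "x \<in> nul (rel_minus s A c)" "x \<in> nul (A\<inverse>)" shows "x \<in> Rc A"
  using assms nul_converse_rel_minus[OF assms(1), of c] Rc_rel_minus[OF assms(1), of c] by (auto simp: Rc_def)

text \<open>Modulo \<open>nul (A\<inverse>)\<close> the relation \<open>A\<close> is single-valued, so the argument for operators applies.\<close>

lemma root_space_injective:
  assumes A: "lin_rel A" and cd: "c \<noteq> d" and r: "r \<in> nul (rel_minus s A c)"
    and y: "(r, y) \<in> rel_minus s A d" "y \<in> nul (A\<inverse>)"
  shows "r \<in> nul (A\<inverse>)"
  using r y
proof (induction arbitrary: y rule: nul_induct)
  case (step r q)
  have N: "subspace (nul (A\<inverse>))" by (simp add: A lin_rel_converse subspace_nul)
  \<comment> \<open>The step from \<open>r\<close> to \<open>q\<close> in \<open>A - c\<close>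
    becomes a step from \<open>r\<close> to \<open>?u\<close> in \<open>A - d\<close>. As
    \<open>?u\<close> and \<open>y\<close> are both images of \<open>r\<close>, they differ by an
    image of 0.\<close>
  let ?u = "q + s (c - d) r"
  have ru: "(r, ?u) \<in> rel_minus s A d" using step.hyps rel_minus_shift by blast
  have "(0, ?u - y) \<in> rel_minus s A d" 
    using lin_rel_diff[OF lin_rel_minus[OF A] ru step.prems(1)] by simp
  then have "?u - y \<in> nul (A\<inverse>)" using nul_converse_image[OF A] nul_0 by blast
  then have "?u - y + y \<in> nul (A\<inverse>)" using N step.prems subspace_add by blast
  then have u: "?u \<in> nul (A\<inverse>)" by simp
  obtain q' where "(q, q') \<in> rel_minus s A c"
    using nul_image[OF lin_rel_minus[OF A] step.hyps(2)] by blast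
  then have q: "(q, q' + s (c - d) q) \<in> rel_minus s A d" (is "(q, ?q2) \<in> _") by (rule rel_minus_shift)
  \<comment> \<open>\<open>A - d\<close> is applied once more, to \<open>?u\<close>. The image lies
    in \<open>nul (A\<inverse>)\<close> along with \<open>?u\<close>, and removing
    \<open>s (c - d) y\<close> shows the same for the image \<open>?q2\<close> of \<open>q\<close>;
    the induction hypothesis then gives \<open>q\<close>, and \<open>?u - q\<close> is a nonzero
    multiple of \<open>r\<close>.\<close>
  have "(?u, ?q2 + s (c - d) y) \<in> rel_minus s A d"
    by (intro lin_rel_add lin_rel_scale lin_rel_minus A q step.prems)
  then have "?q2 + s (c - d) y \<in> nul (A\<inverse>)" using nul_converse_image[OF A u] by blast
  then have "?q2 + s (c - d) y - s (c - d) y \<in> nul (A\<inverse>)"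
    using N step.prems by (intro subspace_diff subspace_scale)
  then have "q \<in> nul (A\<inverse>)" using step.IH[OF q] by simp
  then have "?u - q \<in> nul (A\<inverse>)" using u N subspace_diff by blast
  then show ?case using nul_cancel_scale[OF lin_rel_converse[OF A], of "c - d" r] cd by simp
qed simp

lemma list_all2_choice:
  assumes "list_all2 P cs xs" "\<And>c x. c \<in> set cs \<Longrightarrow> P c x \<Longrightarrow> \<exists>y. P c y \<and> R x y"
  shows "\<exists>ys. list_all2 P cs ys \<and> list_all2 R xs ys"
  using assms
proof (induction rule: list_all2_induct)
  case (Cons c cs x xs)
  then obtain ys where "list_all2 P cs ys \<and> list_all2 R xs ys" by auto
  moreover obtain y where "P c y" "R x y" using Cons by fastforce
  ultimately have "list_all2 P (c # cs) (y # ys) \<and> list_all2 R (x # xs) (y # ys)" by simp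
  then show ?case by blast
qed simp

lemma lin_rel_sum_list:
  "list_all2 (\<lambda>x y. (x, y) \<in> A) xs ys \<Longrightarrow> lin_rel A \<Longrightarrow> (sum_list xs, sum_list ys) \<in> A"
  by (induction rule: list_all2_induct) (auto intro: lin_rel_0 lin_rel_add)

lemma subspace_sum_list: "subspace U \<Longrightarrow> set xs \<subseteq> U \<Longrightarrow> sum_list xs \<in> U"
  by (induction xs) (auto intro: subspace_0 subspace_add)

text \<open>To remove the first vector, \<open>A - d\<close> is applied to the whole sum until that
  vector has become 0. The other vectors move within their own root spaces, and
  \<open>root_space_injective\<close> carries the conclusion back from their images to them.\<close>

lemma root_spaces_independent:
  assumes A: "lin_rel A"
    and "distinct cs" "list_all2 (\<lambda>c x. x \<in> nul (rel_minus s A c)) cs xs" "sum_list xs \<in> nul (A\<inverse>)"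
  shows "set xs \<subseteq> nul (A\<inverse>)"
  using assms(2-)
proof (induction cs arbitrary: xs)
  case (Cons d cs)
  have N: "subspace (nul (A\<inverse>))" by (simp add: A lin_rel_converse subspace_nul)
  obtain r xs' where xs: "xs = r # xs'" "r \<in> nul (rel_minus s A d)"
    "list_all2 (\<lambda>c x. x \<in> nul (rel_minus s A c)) cs xs'"
    using Cons.prems(2) by (auto simp: list_all2_Cons1)
  \<comment> \<open>The other summands change at each step of the chain of \<open>r\<close>, so the
    claim is made for all lists \<open>ys\<close>.\<close>
  have "set ys \<subseteq> nul (A\<inverse>)" if "list_all2 (\<lambda>c x. x \<in> nul (rel_minus s A c)) cs ys"
    "r + sum_list ys \<in> nul (A\<inverse>)" for ys
    using xs(2) that
  proof (induction arbitrary: ys rule: nul_induct)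
    case zero
    then show ?case using Cons.IH Cons.prems(1) by simp
  next
    case (step r q)
    have "\<exists>y. y \<in> nul (rel_minus s A c) \<and> (x, y) \<in> rel_minus s A d"
      if xc: "x \<in> nul (rel_minus s A c)" for c x
    proof -
      obtain x' where x': "x' \<in> nul (rel_minus s A c)" "(x, x') \<in> rel_minus s A c"
        using nul_image[OF lin_rel_minus[OF A] xc] by blast
      have "x' + s (c - d) x \<in> nul (rel_minus s A c)"
        using x' xc A by (intro subspace_add subspace_scale subspace_nul lin_rel_minus)
      then show ?thesis using rel_minus_shift[OF x'(2)] by blast
    qed
    then obtain zs where zs: "list_all2 (\<lambda>c x. x \<in> nul (rel_minus s A c)) cs zs"
      "list_all2 (\<lambda>x y. (x, y) \<in> rel_minus s A d) ys zs"
      using list_all2_choice[OF step.prems(1), of "\<lambda>x y. (x, y) \<in> rel_minus s A d"] by blast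
    have "(r + sum_list ys, q + sum_list zs) \<in> rel_minus s A d"
      using zs(2) step.hyps(1) by (intro lin_rel_add lin_rel_sum_list lin_rel_minus A)
    then have "q + sum_list zs \<in> nul (A\<inverse>)" using nul_converse_image[OF A step.prems(2)] by blast
    then have zN: "set zs \<subseteq> nul (A\<inverse>)" using step.IH zs(1) by blast
    show ?case
    proof
      fix y assume "y \<in> set ys"
      then obtain i where i: "i < length ys" "y = ys ! i" by (metis in_set_conv_nth)
      have len: "length cs = length ys" "length zs = length ys"
        using step.prems(1) zs(2) by (auto dest: list_all2_lengthD)
      have "cs ! i \<noteq> d" using Cons.prems(1) i len by (metis distinct.simps(2) nth_mem)
      moreover have "y \<in> nul (rel_minus s A (cs ! i))"
        using list_all2_nthD2[OF step.prems(1)] i by blast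
      moreover have "(y, zs ! i) \<in> rel_minus s A d" using list_all2_nthD[OF zs(2)] i by blast
      moreover have "zs ! i \<in> nul (A\<inverse>)" using zN i len by auto
      ultimately show "y \<in> nul (A\<inverse>)" using root_space_injective[OF A] by blast
    qed
  qed
  then have xN: "set xs' \<subseteq> nul (A\<inverse>)" using xs Cons.prems(3) by simp
  then have "r + sum_list xs' - sum_list xs' \<in> nul (A\<inverse>)"
    using Cons.prems(3) xs N subspace_sum_list by (intro subspace_diff) auto
  then show ?case using xN xs by simp
qed simp

lemma nul_inter_nul:
  assumes A: "lin_rel A" and "c \<noteq> d" and x: "x \<in> nul (rel_minus s A c)" "x \<in> nul (rel_minus s A d)"
  shows "x \<in> Rc A"
proof -
  have "- x \<in> nul (rel_minus s A d)" using x A by (intro subspace_neg subspace_nul lin_rel_minus)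
  then have "set [x, - x] \<subseteq> nul (A\<inverse>)"
    using assms by (intro root_spaces_independent[of A "[c, d]"]) auto
  then show ?thesis using nul_inter_nul_converse[OF A x(1)] by simp
qed

section \<open>The sum of all root spaces\<close>

lemma nul_subset_total: "lin_rel A \<Longrightarrow> nul (rel_minus s A c) \<subseteq> total_root_space s A"
  unfolding total_root_space_def root_space_Fin[symmetric] using span_superset by blast

lemma nul_converse_subset_total: "lin_rel A \<Longrightarrow> nul (A\<inverse>) \<subseteq> total_root_space s A"
  unfolding total_root_space_def root_space_Infty[symmetric] using span_superset by blast

lemma subspace_total: "subspace (total_root_space s A)"
  by (simp add: total_root_space_def)

lemma total_root_space_least:
  assumes "lin_rel A" "subspace W" "\<And>c. nul (rel_minus s A c) \<subseteq> W" "nul (A\<inverse>) \<subseteq> W"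
  shows "total_root_space s A \<subseteq> W"
  unfolding total_root_space_def
proof (rule span_minimal[OF _ assms(2)], rule UN_least)
  fix z show "root_space s A z \<subseteq> W"
    using assms by (cases z) (auto simp only: root_space_Fin root_space_Infty)
qed

text \<open>A vector of the root space at infinity need not have an image, so the total space cannot
  be shown to lie in \<open>?W\<close>. It lies in \<open>?W\<close> plus that root space, and there
  every image that does exist stays inside.\<close>

lemma total_image:
  assumes A: "lin_rel A" and xy: "(x, y) \<in> A" "x \<in> total_root_space s A"
  shows "y \<in> total_root_space s A"
proof -
  let ?R = "total_root_space s A"
  let ?W = "{a. \<exists>a'\<in>?R. (a, a') \<in> A}"
  have W: "subspace ?W"
    by (rule subspaceI) (use A subspace_total in
      \<open>blast intro: lin_rel_0 lin_rel_add lin_rel_scale subspace_0 subspace_add subspace_scale\<close>)+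
  have N: "subspace (nul (A\<inverse>))" by (simp add: A lin_rel_converse subspace_nul)
  have "?R \<subseteq> ?W + nul (A\<inverse>)"
  proof (rule total_root_space_least[OF A])
    show "subspace (?W + nul (A\<inverse>))" using W N by (rule subspace_sum_sets)
    show "nul (A\<inverse>) \<subseteq> ?W + nul (A\<inverse>)" using subspace_0[OF W] by (rule set_zero_plus2)
    have "nul (rel_minus s A c) \<subseteq> ?W" for c
    proof
      fix a assume a: "a \<in> nul (rel_minus s A c)"
      then obtain b where b: "b \<in> nul (rel_minus s A c)" "(a, b) \<in> rel_minus s A c"
        using nul_image[OF lin_rel_minus[OF A]] by blast
      have "b + s c a \<in> nul (rel_minus s A c)"
        using a b A by (intro subspace_add subspace_scale subspace_nul lin_rel_minus)
      then show "a \<in> ?W" using b nul_subset_total[OF A] by (auto simp: mem_rel_minus)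
    qed
    then show "nul (rel_minus s A c) \<subseteq> ?W + nul (A\<inverse>)" for c
      using set_zero_plus2[of "nul (A\<inverse>)" ?W] nul_0 by (force simp: add.commute)
  qed
  then obtain a b a' where "x = a + b" "(a, a') \<in> A" "a' \<in> ?R" "b \<in> nul (A\<inverse>)"
    using xy by (blast elim: set_plus_elim)
  moreover from this have "(b, y - a') \<in> A" using lin_rel_diff[OF A xy(1)] by fastforce
  ultimately have "y - a' \<in> ?R"
    using nul_converse_image[OF A, of b _ 0] nul_converse_subset_total[OF A] by auto
  then have "y - a' + a' \<in> ?R" using \<open>a' \<in> ?R\<close> subspace_total subspace_add by blast
  then show ?thesis by simp
qed

text \<open>On the root space at \<open>c\<close>, \<open>A - d\<close> acts as \<open>c - d\<close>
  plus a nilpotent part; the preimage is found by dividing by \<open>c - d\<close> along the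
  chain.\<close>

lemma root_space_surjective:
  assumes A: "lin_rel A" and cd: "c \<noteq> d" and x: "x \<in> nul (rel_minus s A c)"
  shows "\<exists>w\<in>nul (rel_minus s A c). (w, x) \<in> rel_minus s A d"
  using x
proof (induction rule: nul_induct)
  case zero
  then show ?case using lin_rel_0[OF lin_rel_minus[OF A]] nul_0 by blast
next
  case (step x y)
  then obtain w where w: "w \<in> nul (rel_minus s A c)" "(w, y) \<in> rel_minus s A d" by blast
  have "(x - w, s (c - d) x) \<in> rel_minus s A d"
    using lin_rel_diff[OF lin_rel_minus[OF A] rel_minus_shift[OF step.hyps(1)] w(2)] by simp
  then have "(s (inverse (c - d)) (x - w), x) \<in> rel_minus s A d"
    using lin_rel_scale[OF lin_rel_minus[OF A], of "x - w" "s (c - d) x" d "inverse (c - d)"] cd by simp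
  moreover have "s (inverse (c - d)) (x - w) \<in> nul (rel_minus s A c)"
    using w nul_step[OF step.hyps(1,2)] A
    by (intro subspace_scale subspace_diff subspace_nul lin_rel_minus)
  ultimately show ?case by blast
qed

text \<open>The counterpart of \<open>total_image\<close>: only the root space at \<open>c\<close>
  itself may lack preimages under \<open>A - c\<close>, and for it every preimage that does exist
  stays inside.\<close>

lemma total_preimage:
  assumes A: "lin_rel A" and xy: "(x, y) \<in> rel_minus s A c" "y \<in> total_root_space s A"
  shows "x \<in> total_root_space s A"
proof -
  let ?R = "total_root_space s A"
  let ?W = "{b. \<exists>b'\<in>?R. (b', b) \<in> rel_minus s A c}"
  have B: "lin_rel (rel_minus s A c)" using A by (rule lin_rel_minus)
  have W: "subspace ?W"
    by (rule subspaceI) (use B subspace_total in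
      \<open>blast intro: lin_rel_0 lin_rel_add lin_rel_scale subspace_0 subspace_add subspace_scale\<close>)+
  have N: "subspace (nul (rel_minus s A c))" using B by (rule subspace_nul)
  have W0: "?W \<subseteq> ?W + nul (rel_minus s A c)"
    using set_zero_plus2[of "nul (rel_minus s A c)" ?W] by (simp add: add.commute)
  have "?R \<subseteq> ?W + nul (rel_minus s A c)"
  proof (rule total_root_space_least[OF A])
    show "subspace (?W + nul (rel_minus s A c))" using W N by (rule subspace_sum_sets)
    have "nul (A\<inverse>) \<subseteq> ?W"
    proof
      fix x assume "x \<in> nul (A\<inverse>)"
      then obtain y where "y \<in> nul (A\<inverse>)" "(y, x) \<in> rel_minus s A c"
        using nul_image[OF lin_rel_converse[OF B], of x] nul_converse_rel_minus[OF A] by auto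
      then show "x \<in> ?W" using nul_converse_subset_total[OF A] by blast
    qed
    then show "nul (A\<inverse>) \<subseteq> ?W + nul (rel_minus s A c)" using W0 by blast
    show "nul (rel_minus s A d) \<subseteq> ?W + nul (rel_minus s A c)" for d
    proof (cases "d = c")
      case True
      then show ?thesis using set_zero_plus2[OF subspace_0[OF W]] by simp
    next
      case False
      then have "nul (rel_minus s A d) \<subseteq> ?W"
        using root_space_surjective[OF A False] nul_subset_total[OF A] by blast
      then show ?thesis using W0 by blast
    qed
  qed
  then obtain a b a' where a: "y = a + b" "(a', a) \<in> rel_minus s A c" "a' \<in> ?R" "b \<in> nul (rel_minus s A c)"
    using xy by (blast elim: set_plus_elim)
  have "(x - a', b) \<in> rel_minus s A c" using lin_rel_diff[OF B xy(1) a(2)] a(1) by simp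
  then have "x - a' \<in> ?R" using a(4) nul_step nul_subset_total[OF A] by blast
  then have "x - a' + a' \<in> ?R" using \<open>a' \<in> ?R\<close> subspace_total subspace_add by blast
  then show ?thesis by simp
qed

lemma total_subset: "lin_rel A \<Longrightarrow> total_root_space s A \<subseteq> Domain A + Range A"
proof (rule total_root_space_least)
  assume A: "lin_rel A"
  have "0 \<in> Domain A" "0 \<in> Range A" using lin_rel_0[OF A] by blast+
  then have sub: "Range A \<subseteq> Domain A + Range A" "Domain A \<subseteq> Domain A + Range A"
    using set_zero_plus2[of "Domain A" "Range A"] set_zero_plus2[of "Range A" "Domain A"]
    by (simp_all add: add.commute)
  show "subspace (Domain A + Range A)" by (intro subspace_sum_sets subspace_Domain subspace_Range A)
  show "nul (rel_minus s A c) \<subseteq> Domain A + Range A" for c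
    using nul_image[OF lin_rel_minus[OF A]] sub(2) by (fastforce simp: mem_rel_minus)
  show "nul (A\<inverse>) \<subseteq> Domain A + Range A"
    using nul_image[OF lin_rel_converse[OF A]] sub(1) by fastforce
qed

section \<open>Long chains and polynomial relations\<close>

lemma linear_dependence:
  fixes y :: "nat \<Rightarrow> 'v"
  shows "\<exists>a. (\<exists>j\<le>card Basis. a j \<noteq> 0) \<and> (\<Sum>j\<le>card Basis. s (a j) (y j)) = 0"
proof (cases "inj_on y {..card Basis}")
  case True
  then have "card (y ` {..card Basis}) = Suc (card Basis)" by (simp add: card_image)
  then have "dependent (y ` {..card Basis})"
    using independent_card_le_dim[of "y ` {..card Basis}" UNIV] by fastforce
  then obtain u where u: "\<exists>v\<in>y ` {..card Basis}. u v \<noteq> 0" "(\<Sum>v\<in>y ` {..card Basis}. s (u v) v) = 0"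
    by (subst (asm) dependent_finite) auto
  have "(\<Sum>j\<le>card Basis. s (u (y j)) (y j)) = 0"
    using u(2) by (simp add: sum.reindex[OF True])
  then show ?thesis using u(1) by (intro exI[of _ "u \<circ> y"]) auto
next
  case False
  \<comment> \<open>\<open>dependent\<close> speaks of sets, so a repeated vector is treated
    separately, by the relation \<open>y i - y j = 0\<close>.\<close>
  then obtain i j where ij: "i \<le> card Basis" "j \<le> card Basis" "i \<noteq> j" "y i = y j" unfolding inj_on_def by auto
  define a :: "nat \<Rightarrow> complex" where "a k = (if k = i then 1 else 0) - (if k = j then 1 else 0)" for k
  have "(\<Sum>k\<le>card Basis. s (a k) (y k))
      = (\<Sum>k\<le>card Basis. (if k = i then y k else 0) - (if k = j then y k else 0))"
    by (rule sum.cong) (auto simp: a_def scale_left_diff_distrib scale_minus_left)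
  also have "\<dots> = y i - y j" using ij by (simp add: sum_subtractf)
  finally have "(\<Sum>k\<le>card Basis. s (a k) (y k)) = 0" using ij by simp
  moreover have "a i \<noteq> 0" using ij by (simp add: a_def)
  ultimately show ?thesis using ij by blast
qed

text \<open>
  Roots of \<open>p\<close> are split off one by one, as \<open>A\<close> has no eigenvalues modulo the root spaces.
\<close>

lemma polynomial_chain_total:
  assumes A: "lin_rel A" and y: "\<And>j. j < N \<Longrightarrow> (y (Suc j), y j) \<in> A"
    and p: "p \<noteq> 0" "degree p \<le> N" "(\<Sum>j\<le>N. s (coeff p j) (y j)) \<in> total_root_space s A"
  shows "y 0 \<in> total_root_space s A"
  using p
proof (induction "degree p" arbitrary: p)
  case 0
  then obtain a where a: "p = [:a:]" "a \<noteq> 0" by (metis degree_eq_zeroE pCons_eq_0_iff)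
  have "(\<Sum>j\<le>N. s (coeff p j) (y j)) = (\<Sum>j\<in>{0}. s (coeff p j) (y j))"
    by (rule sum.mono_neutral_right) (auto simp: a coeff_pCons split: nat.splits)
  then have "s a (y 0) \<in> total_root_space s A" using 0 a by simp
  then have "s (inverse a) (s a (y 0)) \<in> total_root_space s A"
    by (rule subspace_scale[OF subspace_total])
  then show ?case using a by simp
next
  case (Suc m)
  let ?R = "total_root_space s A"
  have "degree p > 0" using Suc.hyps(2) by simp
  then obtain z where "poly p z = 0" using alg_closed_imp_poly_has_root by blast
  then obtain q where q: "p = [:- z, 1:] * q" by (auto simp: poly_eq_0_iff_dvd elim: dvdE)
  then have "q \<noteq> 0" using Suc.prems by auto
  then have deg: "degree p = Suc (degree q)" unfolding q by (subst degree_mult_eq) auto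
  then have dq: "degree q < N" using Suc.prems by simp
  \<comment> \<open>Multiplication by the variable passes from each vector to its predecessor in the
    chain. Hence \<open>q\<close> gives the pair \<open>(u, w)\<close> in \<open>A\<close>, and
    \<open>p\<close> gives \<open>u - s z w\<close>.\<close>
  define u w where "u = (\<Sum>j<N. s (coeff q j) (y (Suc j)))" and "w = (\<Sum>j<N. s (coeff q j) (y j))"
  have uw: "(u, w) \<in> A" unfolding u_def w_def by (rule lin_rel_sum[OF A]) (simp add: y)
  have w: "w = (\<Sum>j\<le>N. s (coeff q j) (y j))"
    unfolding w_def using coeff_eq_0[OF dq] by (simp add: lessThan_Suc_atMost[symmetric])
  have "u = (\<Sum>j\<le>N. s (case j of 0 \<Rightarrow> 0 | Suc i \<Rightarrow> coeff q i) (y j))"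
    unfolding u_def lessThan_Suc_atMost[symmetric] by (subst sum.lessThan_Suc_shift) simp
  moreover have "coeff p j = (case j of 0 \<Rightarrow> 0 | Suc i \<Rightarrow> coeff q i) - z * coeff q j" for j
    unfolding q by (simp add: coeff_pCons split: nat.splits)
  ultimately have sum: "(\<Sum>j\<le>N. s (coeff p j) (y j)) = u - s z w"
    unfolding w by (simp add: scale_left_diff_distrib sum_subtractf scale_sum_right)
  \<comment> \<open>A root \<open>z\<close> belongs to the eigenvalue \<open>inverse z\<close> of
    \<open>A\<close>, and the root 0 to the eigenvalue infinity; both are excluded modulo the root
    spaces.\<close>
  have "w \<in> ?R"
  proof (cases "z = 0")
    case True
    then show ?thesis using total_image[OF A uw] sum Suc.prems by simp
  next
    case False
    have "s (- inverse z) (u - s z w) \<in> ?R" using sum Suc.prems by (intro subspace_scale subspace_total) simp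
    then have "w - s (inverse z) u \<in> ?R" using False by (simp add: scale_right_diff_distrib scale_minus_left)
    moreover have "(u, w - s (inverse z) u) \<in> rel_minus s A (inverse z)" using uw by (simp add: mem_rel_minus)
    ultimately have "u \<in> ?R" using total_preimage[OF A] by blast
    then show ?thesis using total_image[OF A uw] by simp
  qed
  then show ?case using Suc.hyps(1)[of q] deg Suc.hyps(2) \<open>q \<noteq> 0\<close> dq w by simp
qed

lemma Range_relpow_subset_total:
  assumes A: "lin_rel A"
  shows "Range (A ^^ card Basis) \<subseteq> total_root_space s A"
proof
  let ?N = "card Basis"
  fix x assume "x \<in> Range (A ^^ ?N)"
  then obtain f where f: "f ?N = x" "\<And>i. i < ?N \<Longrightarrow> (f i, f (Suc i)) \<in> A"
    by (auto simp: relpow_fun_conv)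
  \<comment> \<open>The chain is numbered backwards, so that the constant polynomial left at the end
    concerns its last vector \<open>x = y 0\<close>.\<close>
  define y where "y j = f (?N - j)" for j
  have y: "(y (Suc j), y j) \<in> A" if "j < ?N" for j
    using f(2)[of "?N - Suc j"] that by (simp add: y_def Suc_diff_Suc)
  obtain a where a: "\<exists>j\<le>?N. a j \<noteq> 0" "(\<Sum>j\<le>?N. s (a j) (y j)) = 0"
    using linear_dependence by blast
  define p where "p = (\<Sum>j\<le>?N. monom (a j) j)"
  have cp: "coeff p j = (if j \<le> ?N then a j else 0)" for j
    by (simp add: p_def coeff_sum)
  have "p \<noteq> 0" using a(1) cp by (metis coeff_0)
  moreover have "degree p \<le> ?N" by (rule degree_le) (simp add: cp)
  moreover have "(\<Sum>j\<le>?N. s (coeff p j) (y j)) = 0" using a(2) by (simp add: cp)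
  ultimately have "y 0 \<in> total_root_space s A"
    using polynomial_chain_total[of A ?N y p, OF A y] subspace_0[OF subspace_total] by simp
  then show "x \<in> total_root_space s A" using f by (simp add: y_def)
qed

section \<open>Shift systems\<close>

lemma Range_relpow_mono: "Range ((A :: ('v \<times> 'v) set) ^^ Suc k) \<subseteq> Range (A ^^ k)"
proof
  fix x assume "x \<in> Range (A ^^ Suc k)"
  then obtain w where "(w, x) \<in> A ^^ Suc k" by blast
  then obtain z where "(z, x) \<in> A ^^ k" by (blast dest: relpow_Suc_D2)
  then show "x \<in> Range (A ^^ k)" by blast
qed

lemma subset_Range_relpow:
  assumes "\<And>x. x \<in> N \<Longrightarrow> \<exists>w\<in>N. (w, x) \<in> A"
  shows "N \<subseteq> Range (A ^^ k)"
proof (induction k)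
  case (Suc k)
  show ?case
  proof
    fix x assume "x \<in> N"
    then obtain w where "w \<in> N" "(w, x) \<in> A" using assms by blast
    moreover from this obtain v where "(v, w) \<in> A ^^ k" using Suc by blast
    ultimately show "x \<in> Range (A ^^ Suc k)" by auto
  qed
qed auto

text \<open>At every point other than 0, infinity included, each vector of the root space has a
  preimage under \<open>A\<close> in the same space, so that space lies in the range of every
  power.\<close>

lemma total_subset_nul_plus_Range:
  assumes A: "lin_rel A"
  shows "total_root_space s A \<subseteq> nul A + Range (A ^^ k)"
proof (rule total_root_space_least[OF A])
  have sR: "subspace (Range (A ^^ k))" using A by (intro subspace_Range lin_rel_relpow)
  show "subspace (nul A + Range (A ^^ k))"
    using sR A by (intro subspace_sum_sets subspace_nul)
  have R: "Range (A ^^ k) \<subseteq> nul A + Range (A ^^ k)" by (rule set_zero_plus2) simp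
  have N: "nul A \<subseteq> nul A + Range (A ^^ k)"
    using set_zero_plus2[OF subspace_0[OF sR], of "nul A"] by (simp add: add.commute)
  have "nul (A\<inverse>) \<subseteq> Range (A ^^ k)"
    by (rule subset_Range_relpow) (use nul_image[OF lin_rel_converse[OF A]] in auto)
  then show "nul (A\<inverse>) \<subseteq> nul A + Range (A ^^ k)" using R by blast
  show "nul (rel_minus s A c) \<subseteq> nul A + Range (A ^^ k)" for c
  proof (cases "c = 0")
    case False
    have "nul (rel_minus s A c) \<subseteq> Range (A ^^ k)"
      by (rule subset_Range_relpow) (use root_space_surjective[OF A False] in auto)
    then show ?thesis using R by blast
  qed (use N in simp)
qed

text \<open>The component of \<open>x\<close> in the root spaces may have no image. It is split into
  a vector of \<open>nul A\<close>, which has an image there, and a vector of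
  \<open>Range (A ^^ k)\<close>, which joins the other component of \<open>x\<close>. Read for the
  inverse, the result is the injectivity between levels of a shift system.\<close>

lemma shift_chain_space_image:
  assumes A: "lin_rel A" and xy: "(x, y) \<in> A" "x \<in> shift_chain_space s A k"
  shows "y \<in> shift_chain_space s A (Suc k)"
proof (cases k)
  case 0
  have "y + 0 \<in> Range (A ^^ 1) + total_root_space s A"
    using xy(1) subspace_0[OF subspace_total] by (intro set_plus_intro) auto
  then show ?thesis by (simp add: shift_chain_space_def 0)
next
  case (Suc j)
  let ?R = "total_root_space s A"
  have sR: "subspace (Range (A ^^ k))" using A by (intro subspace_Range lin_rel_relpow)
  have "x \<in> Range (A ^^ k) + ?R" using xy(2) Suc by (simp add: shift_chain_space_def del: relpow.simps)
  then obtain w r where wr: "w \<in> Range (A ^^ k)" "r \<in> ?R" "x = w + r" by (blast elim: set_plus_elim)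
  obtain r0 r1 where r: "r0 \<in> nul A" "r1 \<in> Range (A ^^ k)" "r = r0 + r1"
    using total_subset_nul_plus_Range[OF A, of k] wr(2) by (blast elim: set_plus_elim)
  obtain r0' where r0': "r0' \<in> nul A" "(r0, r0') \<in> A" using nul_image[OF A r(1)] by blast
  have "(w + r1, y - r0') \<in> A" using lin_rel_diff[OF A xy(1) r0'(2)] wr(3) r(3) by (simp add: algebra_simps)
  moreover have "w + r1 \<in> Range (A ^^ k)" using wr(1) r(2) sR by (intro subspace_add)
  ultimately have "y - r0' \<in> Range (A ^^ Suc k)" by (auto intro: relpow_Suc_I)
  moreover have "r0' \<in> ?R" using r0'(1) nul_subset_total[OF A, of 0] by auto
  ultimately have "(y - r0') + r0' \<in> Range (A ^^ Suc k) + ?R" by (rule set_plus_intro)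
  then show ?thesis by (simp add: shift_chain_space_def del: relpow.simps)
qed

text \<open>The last conjunct allows a pair of \<open>A\<close> to be reduced from its second
  component until the rest lies in the root spaces.\<close>

lemma shift_system_exists:
  assumes A: "lin_rel A"
  shows "\<exists>x. shift_system s A x \<and>
    Domain A + Range A = shift_system_span s A x + total_root_space s A \<and>
    shift_system_span s A x \<inter> total_root_space s A \<subseteq> {0} \<and>
    (\<forall>a b. (a, b) \<in> A \<longrightarrow> (\<exists>u\<in>shift_system_span s A x. \<exists>v\<in>shift_system_span s A x.
      (u, v) \<in> A \<and> b - v \<in> total_root_space s A))"
proof -
  let ?R = "total_root_space s A"
  define V where "V k = shift_chain_space s A k" for k
  define m where "m = shift_length s A"
  have V0: "V 0 = Domain A + Range A" by (simp add: V_def shift_chain_space_def)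
  have VS: "V k = Range (A ^^ k) + ?R" if "k \<ge> 1" for k
    using that by (auto simp: V_def shift_chain_space_def)
  have V: "subspace (V k)" for k
    using A unfolding V_def shift_chain_space_def
    by (auto intro!: subspace_sum_sets subspace_Domain subspace_Range subspace_total lin_rel_relpow)
  have D0: "0 \<in> Domain A" using lin_rel_0[OF A] by blast
  have RV0: "Range A \<subseteq> V 0" unfolding V0 by (rule set_zero_plus2[OF D0])
  have DV0: "Domain A \<subseteq> V 0"
    unfolding V0 using set_zero_plus2[of "Range A" "Domain A"] lin_rel_0[OF A] by (auto simp: add.commute)
  have RV: "?R \<subseteq> V k" for k
  proof (cases "k \<ge> 1")
    case True
    have "0 \<in> Range (A ^^ k)" by (intro subspace_0 subspace_Range lin_rel_relpow A)
    then show ?thesis unfolding VS[OF True] by (rule set_zero_plus2)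
  next
    case False
    then have "k = 0" by simp
    then show ?thesis using total_subset[OF A] V0 by simp
  qed
  have RangeV: "Range (A ^^ k) \<subseteq> V k" if "k \<ge> 1" for k
    unfolding VS[OF that] using set_zero_plus2[OF subspace_0[OF subspace_total[of A]], of "Range (A ^^ k)"]
    by (simp add: add.commute)
  have mono: "V (Suc k) \<subseteq> V k" for k
  proof -
    have "Range (A ^^ Suc k) \<subseteq> V k"
    proof (cases "k \<ge> 1")
      case False
      then have "k = 0" by simp
      then show ?thesis using RV0 by simp
    qed (use Range_relpow_mono RangeV in blast)
    then show ?thesis using set_plus_subset_subspace[OF V _ RV] VS[of "Suc k"] by simp
  qed
  have mono': "V k \<subseteq> V (k - 1)" for k using mono[of "k - 1"] by (cases k) auto
  have image: "b \<in> V (Suc k)" if "(a, b) \<in> A" "a \<in> V k" for a b k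
    using shift_chain_space_image[OF A] that unfolding V_def by blast
  have Vlarge: "V k = ?R" if "k \<ge> 1" "k \<ge> card Basis" for k
  proof -
    have "Range (A ^^ k) \<subseteq> Range (A ^^ card Basis)"
      using lift_Suc_antimono_le[of "\<lambda>k. Range (A ^^ k)"] Range_relpow_mono that by blast
    then have "Range (A ^^ k) \<subseteq> ?R" using Range_relpow_subset_total[OF A] by blast
    then have "V k \<subseteq> ?R"
      unfolding VS[OF that(1)] using set_plus_subset_subspace[OF subspace_total] by blast
    then show ?thesis using RV by blast
  qed
  have m: "1 \<le> m \<and> V (m + 1) = V m"
    unfolding m_def shift_length_def V_def[symmetric]
    by (rule LeastI[of _ "Suc (card Basis)"]) (simp add: Vlarge)
  have stable: "V (Suc (Suc k)) = V (Suc k)" if k: "k \<ge> 1" "V (Suc k) = V k" for k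
  proof
    have "Range (A ^^ Suc k) \<subseteq> V (Suc (Suc k))"
    proof
      fix y assume "y \<in> Range (A ^^ Suc k)"
      then obtain w where "(w, y) \<in> A" "w \<in> Range (A ^^ k)" by auto
      then show "y \<in> V (Suc (Suc k))" using image RangeV[OF k(1)] k(2) by blast
    qed
    then show "V (Suc k) \<subseteq> V (Suc (Suc k))"
      using set_plus_subset_subspace[OF V _ RV] VS[of "Suc k"] by simp
  qed (rule mono)
  have Vm: "V m = ?R"
  proof -
    \<comment> \<open>The sequence is taken from level 1 on, because \<open>stable\<close> holds
      only there; \<open>m - 1\<close> is its index for level \<open>m \<ge> 1\<close>.\<close>
    have "V (Suc (m + card Basis)) = V (Suc (m - 1))"
      by (rule ascending_chain_constant[of "\<lambda>k. V (Suc k)"]) (use m stable in auto)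
    then show ?thesis using m Vlarge[of "Suc (m + card Basis)"] by simp
  qed
  define d where "d k = dim (V k) - dim (V (k + 1))" for k
  have sd: "shift_dim s A k = d k" for k
    unfolding shift_dim_def d_def V_def[symmetric] using V mono by (intro quotient_dim_eq) auto
  \<comment> \<open>The representatives at level \<open>k > 1\<close> lie in the range of
    \<open>A ^^ (k - 1)\<close>, so that they can be followed backwards to a first vector, which may
    be any element of \<open>V 0\<close>.\<close>
  define P where "P k = (if k = 0 then {0} else if k = 1 then V 0 else Range (A ^^ (k - 1)))" for k
  \<comment> \<open>The first vector of a shift chain needs no predecessor: at level 1 the step to
    the conventional 0 is made unconditional.\<close>
  define C where "C k = (if k = 1 then UNIV else A\<inverse>)" for k :: nat
  have "\<exists>x. (\<forall>i. x 0 i = 0) \<and>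
    (\<forall>k\<in>{1..m}. (\<forall>i\<in>{1..dim (V (k - 1)) - dim (V k)}. (x k i, x (k - 1) i) \<in> C k) \<and>
      rel_basis (V (k - 1)) (V k) (dim (V (k - 1)) - dim (V k)) (x k) \<and>
      (k > 1 \<longrightarrow> dim (V (k - 1)) - dim (V k) \<le> dim (V (k - 1 - 1)) - dim (V (k - 1))))"
  proof (rule chain_system_exists[where P = P])
    fix k assume k: "k \<in> {1..m}"
    have "P k \<subseteq> V (k - 1)"
    proof (cases "k = 1")
      case False
      then have "k - 1 \<ge> 1" "k \<noteq> 0" using k by auto
      then show ?thesis using RangeV[of "k - 1"] False by (simp add: P_def)
    qed (simp add: P_def)
    moreover have "lin_rel (C k)" using A by (simp add: C_def lin_rel_UNIV lin_rel_converse)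
    ultimately show "subspace (V (k - 1)) \<and> subspace (V k) \<and> V k \<subseteq> V (k - 1) \<and> P k \<subseteq> V (k - 1) \<and> lin_rel (C k)"
      using V mono' by blast
    show "\<exists>p\<in>P k. u - p \<in> V k" if u: "u \<in> V (k - 1)" for u
    proof (cases "k = 1")
      case True
      then show ?thesis using u subspace_0[OF V] by (auto simp: P_def intro!: bexI[of _ u])
    next
      case False
      then have k1: "k - 1 \<ge> 1" "k \<noteq> 0" using k by auto
      then obtain w r where "w \<in> Range (A ^^ (k - 1))" "r \<in> ?R" "u = w + r"
        using u VS[OF k1(1)] by (blast elim: set_plus_elim)
      then show ?thesis using RV[of k] False k1(2) unfolding P_def by force
    qed
    show "\<exists>y\<in>P (k - 1). (x, y) \<in> C k" if x: "x \<in> P k" for x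
    proof -
      consider "k = 1" | "k = 2" | j where "k = Suc (Suc (Suc j))"
        using k by (cases k; cases "k - 1"; cases "k - 2") auto
      then show ?thesis
      proof cases
        case 2
        then show ?thesis using x DV0 by (auto simp: P_def C_def numeral_2_eq_2)
      next
        case 3
        then show ?thesis using x by (auto simp: P_def C_def)
      qed (auto simp: P_def C_def)
    qed
  next
    fix k x y assume k: "k \<in> {2..m}" and xy: "(x, y) \<in> C k" "y \<in> V (k - 1)"
    then have "(y, x) \<in> A" by (auto simp: C_def)
    then have "x \<in> V (Suc (k - 1))" using image xy by blast
    then show "x \<in> V k" using k by simp
  qed (simp add: P_def)
  then obtain x' where xC: "\<And>k i. k \<in> {1..m} \<Longrightarrow> i \<in> {1..dim (V (k - 1)) - dim (V k)} \<Longrightarrow> (x' k i, x' (k - 1) i) \<in> C k"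
    and xb: "\<And>k. k \<in> {1..m} \<Longrightarrow> rel_basis (V (k - 1)) (V k) (dim (V (k - 1)) - dim (V k)) (x' k)"
    and xd: "\<And>k. k \<in> {1..m} \<Longrightarrow> k > 1 \<Longrightarrow> dim (V (k - 1)) - dim (V k) \<le> dim (V (k - 1 - 1)) - dim (V (k - 1))"
    by blast
  define x where "x k = x' (k + 1)" for k
  have xA: "(x (k - 1) i, x k i) \<in> A" if "k \<in> {1..m-1}" "i \<in> {1..d k}" for k i
    using xC[of "k + 1" i] that by (auto simp: x_def C_def d_def)
  have xb: "rel_basis (V k) (V (k + 1)) (d k) (x k)" if "k \<in> {0..m-1}" for k
  proof -
    have "k + 1 \<in> {1..m}" using that m by auto
    then show ?thesis using xb[of "k + 1"] by (simp add: x_def d_def)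
  qed
  have d: "d k \<le> d (k - 1)" if "k \<in> {1..m-1}" for k
    using xd[of "k + 1"] that by (auto simp: d_def)
  have ss: "shift_system s A x"
    unfolding shift_system_def sd m_def[symmetric] V_def[symmetric]
  proof (intro conjI ballI)
    show "(x (k - 1) i, x k i) \<in> A" if "k \<in> {1..m-1}" "i \<in> {1..d k}" for k i using xA that .
    show "quotient_basis s (V k) (V (k + 1)) (d k) (\<lambda>i. x k i +o V (k + 1))" if "k \<in> {0..m-1}" for k
      using xb[OF that] by (subst quotient_basis_iff[OF V V]) (auto simp: rel_basis_def)
  qed
  define S where "S = {x k i | k i. k \<in> {0..m-1} \<and> i \<in> {1..d k}}"
  have span: "shift_system_span s A x = span S"
    by (simp only: shift_system_span_def sd S_def flip: m_def)
  \<comment> \<open>\<open>span_rel_bases\<close> expects an ascending filtration, hence the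
    reversed index: the bottom is \<open>V m\<close>, the total root space, and the top is
    \<open>V 0\<close>.\<close>
  have "V (m - m) = span {x (m - k) i | k i. k \<in> {1..m} \<and> i \<in> {1..d (m - k)}} + V (m - 0) \<and>
    span {x (m - k) i | k i. k \<in> {1..m} \<and> i \<in> {1..d (m - k)}} \<inter> V (m - 0) \<subseteq> {0}"
  proof (rule span_rel_bases)
    fix k assume k: "k \<in> {1..m}"
    then have "m - (k - 1) = m - k + 1" by auto
    then show "V (m - (k - 1)) \<subseteq> V (m - k)" "rel_basis (V (m - k)) (V (m - (k - 1))) (d (m - k)) (x (m - k))"
      using mono[of "m - k"] xb[of "m - k"] k by auto
  qed (rule V)
  moreover have "{x (m - k) i | k i. k \<in> {1..m} \<and> i \<in> {1..d (m - k)}} = S"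
  proof
    show "{x (m - k) i | k i. k \<in> {1..m} \<and> i \<in> {1..d (m - k)}} \<subseteq> S"
      unfolding S_def by fastforce
    show "S \<subseteq> {x (m - k) i | k i. k \<in> {1..m} \<and> i \<in> {1..d (m - k)}}"
    proof
      fix z assume "z \<in> S"
      then obtain k i where "k \<in> {0..m-1}" "i \<in> {1..d k}" "z = x k i" unfolding S_def by blast
      then have "z = x (m - (m - k)) i" "m - k \<in> {1..m}" "i \<in> {1..d (m - (m - k))}" using m by auto
      then show "z \<in> {x (m - k) i | k i. k \<in> {1..m} \<and> i \<in> {1..d (m - k)}}" by blast
    qed
  qed
  ultimately have VR: "Domain A + Range A = span S + ?R" "span S \<inter> ?R \<subseteq> {0}"
    using V0 Vm by auto
  have xS: "x k i \<in> span S" if "k \<in> {0..m-1}" "i \<in> {1..d k}" for k i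
    using that unfolding S_def by (intro span_base) blast
  have dec: "\<exists>u\<in>span S. \<exists>v\<in>span S. (u, v) \<in> A \<and> b - v \<in> ?R" if ab: "(a, b) \<in> A" for a b
  proof -
    \<comment> \<open>The reduction starts from \<open>b\<close>, which lies in \<open>V 1\<close>.
      Only system vectors of positive level are then subtracted from it, and each of these has a
      predecessor in the system to be subtracted from \<open>a\<close>.\<close>
    have "\<exists>u\<in>span S. \<exists>v\<in>span S. (u, v) \<in> A \<and> b - v \<in> V (Suc k)" if "k < m" for k
      using that
    proof (induction k)
      case 0
      have "b \<in> V 1" using RangeV[of 1] ab by auto
      then show ?case using lin_rel_0[OF A] span_zero[of S] by (metis One_nat_def diff_zero)
    next
      case (Suc k)
      then obtain u v where uv: "u \<in> span S" "v \<in> span S" "(u, v) \<in> A" "b - v \<in> V (Suc k)" by auto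
      let ?k = "Suc k"
      have k: "?k \<in> {0..m-1}" "?k \<in> {1..m-1}" "k \<in> {0..m-1}" using Suc.prems by auto
      obtain c where c: "b - v - lincomb (d ?k) (x ?k) c \<in> V (?k + 1)"
        using xb[OF k(1)] uv(4) unfolding rel_basis_def by blast
      have dk: "d ?k \<le> d k" using d[OF k(2)] by simp
      have "(lincomb (d ?k) (x k) c, lincomb (d ?k) (x ?k) c) \<in> A"
        using xA[OF k(2)] by (intro lin_rel_lincomb A) simp
      then have "(u + lincomb (d ?k) (x k) c, v + lincomb (d ?k) (x ?k) c) \<in> A"
        using uv by (intro lin_rel_add A)
      moreover have "u + lincomb (d ?k) (x k) c \<in> span S" "v + lincomb (d ?k) (x ?k) c \<in> span S"
        using uv xS k dk by (auto intro!: span_add lincomb_mem)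
      moreover have "b - (v + lincomb (d ?k) (x ?k) c) \<in> V (Suc ?k)" using c by (simp add: algebra_simps)
      ultimately show ?case by blast
    qed
    from this[of "m - 1"] show ?thesis using m Vm by simp
  qed
  show ?thesis
    by (intro exI[of _ x] conjI, unfold span) (use ss VR dec in auto)
qed

end

section \<open>Lists of subspaces\<close>

lemma mem_sum_list_iff:
  fixes Us :: "'a::ab_group_add set list"
  shows "x \<in> sum_list Us \<longleftrightarrow> (\<exists>us. list_all2 (\<in>) us Us \<and> x = sum_list us)"
proof (induction Us arbitrary: x)
  case (Cons U Us)
  show ?case
  proof
    assume "x \<in> sum_list (U # Us)"
    then obtain u v where uv: "u \<in> U" "v \<in> sum_list Us" "x = u + v" by (auto elim: set_plus_elim)
    obtain us where "list_all2 (\<in>) us Us" "v = sum_list us" using uv(2) Cons.IH by blast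
    then have "list_all2 (\<in>) (u # us) (U # Us)" "x = sum_list (u # us)" using uv by auto
    then show "\<exists>us. list_all2 (\<in>) us (U # Us) \<and> x = sum_list us" by blast
  next
    assume "\<exists>us. list_all2 (\<in>) us (U # Us) \<and> x = sum_list us"
    then obtain u us where "u \<in> U" "list_all2 (\<in>) us Us" "x = u + sum_list us"
      by (auto simp: list_all2_Cons2)
    then show "x \<in> sum_list (U # Us)" using Cons.IH by auto
  qed
qed simp

lemma independent_subspaces_iff:
  "independent_subspaces Us \<longleftrightarrow> (\<forall>us. list_all2 (\<in>) us Us \<and> sum_list us = 0 \<longrightarrow> set us \<subseteq> {0})"
  unfolding independent_subspaces_def list_all2_conv_all_nth subset_iff in_set_conv_nth by auto metis

lemma fst_sum_list: "fst (sum_list ps) = sum_list (map fst ps)"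
  and snd_sum_list: "snd (sum_list ps) = sum_list (map snd ps)"
  by (induction ps) auto

text \<open>A vanishing sum of pairs vanishes in each component, and each component is a vanishing
  sum of vectors of the spaces \<open>Hs\<close>.\<close>

lemma independent_graph_restrictions:
  assumes "independent_subspaces Hs"
  shows "independent_subspaces (map (graph_restriction A) Hs)"
  unfolding independent_subspaces_iff
proof (intro allI impI)
  fix ps assume ps: "list_all2 (\<in>) ps (map (graph_restriction A) Hs) \<and> sum_list ps = 0"
  have "list_all2 (\<in>) (map fst ps) Hs" "list_all2 (\<in>) (map snd ps) Hs"
    using ps by (auto simp: list_all2_conv_all_nth graph_restriction_def mem_Times_iff)
  moreover have "sum_list (map fst ps) = 0" "sum_list (map snd ps) = 0"
    using ps by (simp_all flip: fst_sum_list snd_sum_list)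
  ultimately have "set (map fst ps) \<subseteq> {0}" "set (map snd ps) \<subseteq> {0}"
    using assms unfolding independent_subspaces_iff by blast+
  then show "set ps \<subseteq> {0}" by (auto simp: zero_prod_def)
qed

lemma converse_graph_restriction: "(graph_restriction A X)\<inverse> = graph_restriction (A\<inverse>) X"
  by (auto simp: graph_restriction_def)

context complex_fd_space
begin

lemma subspace_sum_list_sets: "\<forall>U\<in>set Us. subspace U \<Longrightarrow> subspace (sum_list Us)"
  by (induction Us) (auto intro: subspace_sum_sets)

lemma subset_sum_list_sets:
  assumes "\<forall>U\<in>set Us. subspace U" "U \<in> set Us"
  shows "U \<subseteq> sum_list Us"
  using assms
proof (induction Us)
  case (Cons W Us)
  have "0 \<in> W" "0 \<in> sum_list Us"
    using Cons.prems subspace_0 subspace_sum_list_sets[of Us] by auto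
  then show ?case
    using Cons set_zero_plus2[of W "sum_list Us"] set_zero_plus2[of "sum_list Us" W]
    by (auto simp: add.commute)
qed simp

lemma sum_list_sets_subset:
  "subspace W \<Longrightarrow> \<forall>U\<in>set Us. U \<subseteq> W \<Longrightarrow> sum_list Us \<subseteq> W"
  by (induction Us) (simp_all add: subspace_0 set_plus_subset_subspace)

lemma lin_rel_sum_list_mem: "lin_rel A \<Longrightarrow> set ps \<subseteq> A \<Longrightarrow> sum_list ps \<in> A"
proof (induction ps)
  case (Cons p ps)
  then show ?case using lin_rel_add[of A "fst p" "snd p" "fst (sum_list ps)" "snd (sum_list ps)"]
    by (simp add: plus_prod_def)
qed (simp add: lin_rel_0 zero_prod_def)

section \<open>The restrictions\<close>

text \<open>A chain of \<open>A\<close> from a vector of \<open>Rc A\<close> to 0 never leaves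
  \<open>Rc A\<close>: its members lie in \<open>nul A\<close>, and as images of vectors of
  \<open>nul (A\<inverse>)\<close> they stay there too. The same for the inverse makes the
  restriction completely singular.\<close>

lemma Rc_subset_nul_restriction:
  assumes "lin_rel A"
  shows "Rc A \<subseteq> nul (graph_restriction A (Rc A))"
proof
  fix x assume "x \<in> Rc A"
  then have "x \<in> nul A" "x \<in> nul (A\<inverse>)" by (auto simp: Rc_def)
  then show "x \<in> nul (graph_restriction A (Rc A))"
  proof (induction rule: nul_induct)
    case (step x y)
    have y: "y \<in> nul (A\<inverse>)" using step.hyps(1) step.prems nul_step[of y x "A\<inverse>"] by simp
    then have "(x, y) \<in> graph_restriction A (Rc A)"
      using step nul_step[of x y A] by (auto simp: graph_restriction_def Rc_def)
    then show ?case using step.IH[OF y] by (rule nul_step)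
  qed simp
qed

lemma completely_singular_restriction:
  assumes A: "lin_rel A"
  shows "completely_singular_in s (Rc A) (graph_restriction A (Rc A))"
proof -
  let ?S = "graph_restriction A (Rc A)"
  have S: "lin_rel ?S" using A by (intro lin_rel_restriction subspace_Rc)
  have "Rc A \<subseteq> Rc ?S"
    using Rc_subset_nul_restriction[OF A] Rc_subset_nul_restriction[OF lin_rel_converse[OF A]]
    unfolding Rc_def[of ?S] converse_graph_restriction by simp
  then show ?thesis
    unfolding completely_singular_in_def linear_relation_in_iff singular_chain_space_eq[OF S]
    using S by (auto simp: graph_restriction_def)
qed

text \<open>A vector of \<open>X\<close> that is an image of 0, or an eigenvector for some
  \<open>d \<noteq> c\<close>, lies in two different root spaces, hence in \<open>Rc A\<close>, and
  is 0.\<close>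

lemma jordan_operator_restriction:
  assumes A: "lin_rel A" and X: "subspace X" "X \<subseteq> nul (rel_minus s A c)" "X \<inter> Rc A \<subseteq> {0}"
    and img: "\<forall>u\<in>X. \<exists>v\<in>X. (u, v) \<in> rel_minus s A c"
    and ker: "\<exists>u\<in>X. u \<noteq> 0 \<and> (u, 0) \<in> rel_minus s A c"
  shows "jordan_operator_in s X c (graph_restriction A X)"
proof -
  let ?J = "graph_restriction A X"
  have J: "lin_rel ?J" using A X by (intro lin_rel_restriction)
  have 1: "Domain ?J = X"
  proof
    show "X \<subseteq> Domain ?J"
    proof
      fix u assume u: "u \<in> X"
      then obtain v where v: "v \<in> X" "(u, v + s c u) \<in> A" using img by (auto simp: mem_rel_minus)
      moreover have "v + s c u \<in> X" using u v X by (intro subspace_add subspace_scale)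
      ultimately show "u \<in> Domain ?J" using u by (auto simp: graph_restriction_def)
    qed
  qed (auto simp: graph_restriction_def)
  have 2: "rel_mul ?J = {0}"
  proof
    show "rel_mul ?J \<subseteq> {0}"
    proof
      fix y assume "y \<in> rel_mul ?J"
      then have y: "(0, y) \<in> A" "y \<in> X" by (auto simp: rel_mul_def graph_restriction_def)
      then have "y \<in> nul (A\<inverse>)" using nul_step[of y 0 "A\<inverse>"] by simp
      then have "y \<in> Rc A" using nul_inter_nul_converse[OF A] X(2) y by blast
      then show "y \<in> {0}" using X(3) y by blast
    qed
  qed (use lin_rel_0[OF J] in \<open>simp add: rel_mul_def\<close>)
  have 3: "rel_ker (rel_minus s ?J d) \<noteq> {0} \<longleftrightarrow> d = c" for d
  proof
    assume ne: "rel_ker (rel_minus s ?J d) \<noteq> {0}"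
    have "0 \<in> rel_ker (rel_minus s ?J d)"
      using lin_rel_0[OF lin_rel_minus[OF J]] by (simp add: rel_ker_def)
    then obtain u where u: "u \<noteq> 0" "(u, 0) \<in> rel_minus s ?J d" using ne by (auto simp: rel_ker_def)
    then have uX: "u \<in> X" "(u, 0) \<in> rel_minus s A d" by (auto simp: mem_rel_minus graph_restriction_def)
    then have "u \<in> nul (rel_minus s A d)" using nul_step nul_0 by blast
    then show "d = c" using nul_inter_nul[OF A, of d c u] uX u X by blast
  next
    assume "d = c"
    then obtain u where "u \<in> X" "u \<noteq> 0" "(u, 0) \<in> rel_minus s A d" using ker by blast
    moreover from this have "(u, 0) \<in> rel_minus s ?J d"
      using X subspace_scale by (auto simp: mem_rel_minus graph_restriction_def)
    ultimately show "rel_ker (rel_minus s ?J d) \<noteq> {0}" by (auto simp: rel_ker_def)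
  qed
  have "point_spectrum s ?J = {Fin c}" unfolding point_spectrum_def 3 by (simp add: 2)
  then show ?thesis
    using J 1 2 unfolding jordan_operator_in_def linear_relation_in_iff by (auto simp: graph_restriction_def)
qed

lemma multishift_restriction:
  assumes A: "lin_rel A" and M: "subspace M" "M \<inter> total_root_space s A \<subseteq> {0}"
  shows "multishift_in s M (graph_restriction A M)"
proof -
  let ?M = "graph_restriction A M"
  have LM: "lin_rel ?M" using A M by (intro lin_rel_restriction)
  have "rel_ker (rel_minus s ?M c) = {0}" for c
  proof
    show "rel_ker (rel_minus s ?M c) \<subseteq> {0}"
    proof
      fix u assume "u \<in> rel_ker (rel_minus s ?M c)"
      then have u: "u \<in> M" "(u, 0) \<in> rel_minus s A c"
        by (auto simp: rel_ker_def mem_rel_minus graph_restriction_def)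
      then have "u \<in> nul (rel_minus s A c)" using nul_step nul_0 by blast
      then show "u \<in> {0}" using u M nul_subset_total[OF A] by blast
    qed
  qed (use lin_rel_0[OF lin_rel_minus[OF LM]] in \<open>simp add: rel_ker_def\<close>)
  moreover have "rel_mul ?M = {0}"
  proof
    show "rel_mul ?M \<subseteq> {0}"
    proof
      fix y assume "y \<in> rel_mul ?M"
      then have y: "(0, y) \<in> A" "y \<in> M" by (auto simp: rel_mul_def graph_restriction_def)
      then have "y \<in> nul (A\<inverse>)" using nul_step[of y 0 "A\<inverse>"] by simp
      then show "y \<in> {0}" using y M nul_converse_subset_total[OF A] by blast
    qed
  qed (use lin_rel_0[OF LM] in \<open>simp add: rel_mul_def\<close>)
  ultimately have "point_spectrum s ?M = {}" by (simp add: point_spectrum_def)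
  then show ?thesis
    using LM unfolding multishift_in_def linear_relation_in_iff by (auto simp: graph_restriction_def)
qed

lemma nul_trivial: "rel_ker B = {0} \<Longrightarrow> nul B \<subseteq> {0}"
proof
  fix x assume B: "rel_ker B = {0}" and "x \<in> nul B"
  from this(2) show "x \<in> {0}"
    by (induction rule: nul_induct) (use B in \<open>auto simp: rel_ker_def\<close>)
qed

text \<open>Points outside the proper point spectrum contribute nothing new to the total root space,
  so the finitely many entries of \<open>lams\<close> suffice in the decomposition.\<close>

lemma nul_subset_Rc:
  assumes A: "lin_rel A" and c: "Fin c \<notin> proper_point_spectrum s A"
  shows "nul (rel_minus s A c) \<subseteq> Rc A"
proof (cases "Fin c \<in> point_spectrum s A")
  case True
  then show ?thesis
    using c root_space_Fin[OF A, of c] singular_chain_space_eq[OF A] by (auto simp: proper_point_spectrum_def)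
next
  case False
  then have "rel_ker (rel_minus s A c) = {0}" by (auto simp: point_spectrum_def)
  then show ?thesis using nul_trivial subspace_0[OF subspace_Rc[OF A]] by blast
qed

lemma nul_converse_subset_Rc:
  assumes A: "lin_rel A" and c: "Infty \<notin> proper_point_spectrum s A"
  shows "nul (A\<inverse>) \<subseteq> Rc A"
proof (cases "Infty \<in> point_spectrum s A")
  case True
  then show ?thesis
    using c root_space_Infty[OF A] singular_chain_space_eq[OF A] by (auto simp: proper_point_spectrum_def)
next
  case False
  then have "rel_ker (A\<inverse>) = {0}" by (auto simp: point_spectrum_def rel_ker_def rel_mul_def split: if_splits)
  then show ?thesis using nul_trivial subspace_0[OF subspace_Rc[OF A]] by blast
qed

text \<open>All notions at infinity are those of the inverse relation at 0, so no second
  construction is needed there.\<close>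

lemma mul_chain_space_eq:
  "lin_rel A \<Longrightarrow> mul_chain_space s A k = ker_chain_space s (A\<inverse>) 0 k"
  by (simp add: mul_chain_space_def ker_chain_space_def rel_mul_relpow singular_chain_space_eq lin_rel_converse)

lemma jordan_system_inf_iff:
  assumes "lin_rel A"
  shows "jordan_system_inf s A x \<longleftrightarrow> jordan_system s (A\<inverse>) 0 x"
  using mul_chain_space_eq[OF assms]
  by (simp add: jordan_system_inf_def jordan_system_def weyr_dim_def weyr_dim_inf_def
      jordan_length_def jordan_length_inf_def)

lemma jordan_system_inf_span_eq:
  assumes "lin_rel A"
  shows "jordan_system_inf_span s A x = jordan_system_span s (A\<inverse>) 0 x"
  using mul_chain_space_eq[OF assms]
  by (simp add: jordan_system_inf_span_def jordan_system_span_def weyr_dim_def weyr_dim_inf_def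
      jordan_length_def jordan_length_inf_def)

section \<open>The decomposition\<close>

text \<open>The assumptions keep only what each kind of system supplies: images inside
  \<open>X c\<close>, preimages inside \<open>Y\<close>, and for \<open>M\<close> the reduction of
  the second component of a pair.\<close>

lemma decomposition:
  assumes A: "lin_rel A" and lams: "distinct lams"
    and proper: "set lams = {c. Fin c \<in> proper_point_spectrum s A}"
    and X: "\<And>c. c \<in> set lams \<Longrightarrow> subspace (X c) \<and> nul (rel_minus s A c) = X c + Rc A \<and> X c \<inter> Rc A \<subseteq> {0} \<and>
      (\<forall>u\<in>X c. \<exists>v\<in>X c. (u, v) \<in> rel_minus s A c)"
    and Y: "subspace Y" "nul (A\<inverse>) = Y + Rc A" "Y \<inter> Rc A \<subseteq> {0}" "\<forall>u\<in>Y. \<exists>v\<in>Y. (v, u) \<in> A"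
    and M: "subspace M" "Domain A + Range A = M + total_root_space s A" "M \<inter> total_root_space s A \<subseteq> {0}"
      "\<forall>a b. (a, b) \<in> A \<longrightarrow> (\<exists>u\<in>M. \<exists>v\<in>M. (u, v) \<in> A \<and> b - v \<in> total_root_space s A)"
  shows "is_direct_sum (Domain A + Range A) (Rc A # map X lams @ [Y, M])"
    and "reducing_sum_decomposition s A (Rc A # map X lams @ [Y, M])
      (map (graph_restriction A) (Rc A # map X lams @ [Y, M]))"
proof -
  let ?R = "total_root_space s A"
  let ?Hs = "Rc A # map X lams @ [Y, M]"
  let ?Ks = "Rc A # map X lams @ [Y]"
  have sRc: "subspace (Rc A)" using A by (rule subspace_Rc)
  have sKs: "\<forall>U\<in>set ?Ks. subspace U" using sRc X Y by auto
  have sHs: "\<forall>U\<in>set ?Hs. subspace U" using sKs M by auto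
  have Xnul: "X c \<subseteq> nul (rel_minus s A c)" if "c \<in> set lams" for c
    using X[OF that] set_zero_plus2[OF subspace_0[OF sRc], of "X c"] by (auto simp: add.commute)
  have Ynul: "Y \<subseteq> nul (A\<inverse>)"
    using Y(2) set_zero_plus2[OF subspace_0[OF sRc], of Y] by (auto simp: add.commute)
  have RcR: "Rc A \<subseteq> ?R" using Rc_subset_nul nul_subset_total[OF A, of 0] by fastforce
  have KR: "sum_list ?Ks = ?R"
  proof
    show "sum_list ?Ks \<subseteq> ?R"
    proof (intro sum_list_sets_subset subspace_total ballI)
      fix U assume "U \<in> set ?Ks"
      then consider "U = Rc A" | "U = Y" | c where "c \<in> set lams" "U = X c" by auto
      then show "U \<subseteq> ?R"
        by cases (use RcR Xnul nul_subset_total[OF A] Ynul nul_converse_subset_total[OF A] in blast)+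
    qed
    have K: "subspace (sum_list ?Ks)" using sKs by (rule subspace_sum_list_sets)
    have sub: "U \<subseteq> sum_list ?Ks" if "U \<in> set ?Ks" for U using subset_sum_list_sets[OF sKs that] .
    show "?R \<subseteq> sum_list ?Ks"
    proof (rule total_root_space_least[OF A K])
      show "nul (A\<inverse>) \<subseteq> sum_list ?Ks"
        unfolding Y(2) using sub[of Y] sub[of "Rc A"] by (intro set_plus_subset_subspace K) auto
      show "nul (rel_minus s A c) \<subseteq> sum_list ?Ks" for c
      proof (cases "c \<in> set lams")
        case True
        then show ?thesis
          using X[OF True] sub[of "X c"] sub[of "Rc A"]
          by (metis K insertCI image_eqI list.set_map list.simps(15) set_append Un_iff set_plus_subset_subspace)
      next
        case False
        then have "nul (rel_minus s A c) \<subseteq> Rc A" using nul_subset_Rc[OF A] proper by blast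
        then show ?thesis using sub[of "Rc A"] by auto
      qed
    qed
  qed
  have "sum_list ?Hs = sum_list ?Ks + M" by (simp add: add.assoc)
  then have sum: "Domain A + Range A = sum_list ?Hs" unfolding KR M(2) by (simp add: add.commute)
  have ind: "independent_subspaces ?Hs"
    unfolding independent_subspaces_iff
  proof (intro allI impI)
    fix us assume us: "list_all2 (\<in>) us ?Hs \<and> sum_list us = 0"
    then obtain c xs a b where us_eq: "us = c # xs @ [a, b]" and mem: "c \<in> Rc A" "a \<in> Y" "b \<in> M"
      and xs: "list_all2 (\<in>) xs (map X lams)"
      by (auto simp: list_all2_Cons2 list_all2_append2)
    have total: "c + (sum_list xs + (a + b)) = 0" using us us_eq by simp
    \<comment> \<open>All components but \<open>b\<close> lie in the total root space, which meets
      \<open>M\<close> only in 0.\<close>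
    have "c + (sum_list xs + a) \<in> sum_list ?Ks"
      unfolding mem_sum_list_iff
      by (rule exI[of _ "c # xs @ [a]"]) (use mem xs in \<open>auto intro: list_all2_appendI\<close>)
    then have "- (c + (sum_list xs + a)) \<in> ?R" unfolding KR by (rule subspace_neg[OF subspace_total])
    moreover have "- (c + (sum_list xs + a)) = b" using total by (simp add: algebra_simps add_eq_0_iff)
    ultimately have b: "b = 0" using M(3) mem by auto
    have xs': "list_all2 (\<lambda>c x. x \<in> nul (rel_minus s A c)) lams xs"
      using xs Xnul by (auto simp: list_all2_conv_all_nth) (metis nth_mem subsetD)
    have N: "subspace (nul (A\<inverse>))" by (simp add: A lin_rel_converse subspace_nul)
    \<comment> \<open>Next the components at infinity and in \<open>Rc A\<close> are moved to the
      other side; independence modulo \<open>nul (A\<inverse>)\<close> then forces each entry of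
      \<open>xs\<close> into \<open>Rc A\<close>.\<close>
    have "- (c + a) \<in> nul (A\<inverse>)"
      using mem Ynul by (intro subspace_neg[OF N] subspace_add[OF N]) (auto simp: Rc_def)
    moreover have "sum_list xs = - (c + a)" using total b by (simp add: algebra_simps add_eq_0_iff)
    ultimately have xsN: "set xs \<subseteq> nul (A\<inverse>)" using root_spaces_independent[OF A lams xs'] by simp
    have xs0: "set xs \<subseteq> {0}"
    proof
      fix x assume "x \<in> set xs"
      then obtain i where i: "i < length xs" "x = xs ! i" by (metis in_set_conv_nth)
      then have l: "lams ! i \<in> set lams" "x \<in> X (lams ! i)"
        using xs by (auto simp: list_all2_conv_all_nth)
      then have "x \<in> Rc A"
        using nul_inter_nul_converse[OF A] Xnul xsN \<open>x \<in> set xs\<close> by blast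
      then show "x \<in> {0}" using X l by blast
    qed
    then have "sum_list xs = 0" using subspace_sum_list[OF subspace_single_0] by blast
    then have "a = - c" using total b by (simp add: add_eq_0_iff)
    then have "a \<in> Rc A" using mem subspace_neg[OF sRc] by blast
    then have "a = 0" using Y(3) mem by blast
    then show "set us \<subseteq> {0}" using us_eq b xs0 \<open>a = - c\<close> by simp
  qed
  show "is_direct_sum (Domain A + Range A) ?Hs" using sum ind by (simp only: is_direct_sum_def)
  have "A \<subseteq> sum_list (map (graph_restriction A) ?Hs)"
  proof (rule subrelI)
    fix x y assume xy: "(x, y) \<in> A"
    then obtain u v where uv: "u \<in> M" "v \<in> M" "(u, v) \<in> A" "y - v \<in> ?R" using M(4) by blast
    have xyuv: "(x - u, y - v) \<in> A" using lin_rel_diff[OF A xy uv(3)] .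
    then have "x - u \<in> ?R" using total_preimage[OF A, of "x - u" "y - v" 0] uv(4) by simp
    then obtain us where us: "list_all2 (\<in>) us ?Ks" "x - u = sum_list us"
      unfolding KR[symmetric] mem_sum_list_iff by blast
    then obtain c xs a where us_eq: "us = c # xs @ [a]" and mem: "c \<in> Rc A" "a \<in> Y"
      and xs: "list_all2 (\<in>) xs (map X lams)"
      by (auto simp: list_all2_Cons2 list_all2_append2)
    have xu: "x - u = c + (sum_list xs + a)" using us us_eq by simp
    obtain c' where c': "c' \<in> Rc A" "(c, c') \<in> A" using Rc_image[OF A mem(1)] by blast
    have "\<exists>y. y \<in> X c \<and> (x, y) \<in> A" if c: "c \<in> set lams" and x: "x \<in> X c" for c x
    proof -
      obtain v where v: "v \<in> X c" "(x, v + s c x) \<in> A" using X[OF c] x by (auto simp: mem_rel_minus)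
      moreover have "v + s c x \<in> X c" using v x X[OF c] by (intro subspace_add subspace_scale) auto
      ultimately show ?thesis by blast
    qed
    moreover have "list_all2 (\<lambda>c x. x \<in> X c) lams xs" using xs by (auto simp: list_all2_conv_all_nth)
    ultimately obtain ys where ys: "list_all2 (\<lambda>c x. x \<in> X c) lams ys" "list_all2 (\<lambda>x y. (x, y) \<in> A) xs ys"
      using list_all2_choice[of "\<lambda>c x. x \<in> X c" lams xs "\<lambda>x y. (x, y) \<in> A"] by blast
    \<comment> \<open>What remains of \<open>y\<close> after subtracting images of all components of
      \<open>x\<close> except \<open>a\<close>, the one at infinity, which is not known to have an
      image in \<open>Y\<close>.\<close>
    define w where "w = y - v - c' - sum_list ys"
    have "(x - u - c - sum_list xs, w) \<in> A"
      unfolding w_def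
      using lin_rel_diff[OF A lin_rel_diff[OF A xyuv c'(2)] lin_rel_sum_list[OF ys(2) A]] .
    then have aw: "(a, w) \<in> A" using xu by simp
    then have "w \<in> nul (A\<inverse>)" using mem Ynul nul_step[of w a "A\<inverse>"] by auto
    then obtain z d where zd: "z \<in> Y" "d \<in> Rc A" "w = z + d" unfolding Y(2) by (blast elim: set_plus_elim)
    obtain z' where z': "z' \<in> Y" "(z', z) \<in> A" using Y(4) zd by blast
    obtain d' where d': "d' \<in> Rc A" "(d', d) \<in> A" using Rc_preimage[OF A zd(2)] by blast
    \<comment> \<open>Comparing \<open>a\<close> with preimages of the two parts of \<open>w\<close>
      gives a kernel vector that also lies in \<open>nul (A\<inverse>)\<close>, hence in
      \<open>Rc A\<close>. As \<open>a - z'\<close> lies in \<open>Y\<close>, it follows that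
      \<open>a = z'\<close>.\<close>
    have "(a - z' - d', w - z - d) \<in> A" using aw z' d' by (intro lin_rel_diff A)
    then have "a - z' - d' \<in> nul A" using zd nul_step[of "a - z' - d'" 0 A] by simp
    moreover have "a - z' - d' \<in> nul (A\<inverse>)"
      using mem z' d' Ynul A by (intro subspace_diff subspace_nul lin_rel_converse) (auto simp: Rc_def)
    ultimately have "a - z' - d' \<in> Rc A" by (simp add: Rc_def)
    then have "a - z' - d' + d' \<in> Rc A" using d' subspace_add[OF sRc] by blast
    then have "a - z' \<in> Rc A" by simp
    moreover have "a - z' \<in> Y" using mem z' Y(1) subspace_diff by blast
    ultimately have az: "a = z'" using Y(3) by auto
    \<comment> \<open>The remainder \<open>(0, d)\<close> is a pair of \<open>A\<close> with both
      components in \<open>Rc A\<close>; it is added to the pair \<open>(c, c')\<close>.\<close>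
    have "(c + (a - z'), c' + (w - z)) \<in> A" using c' aw z' by (intro lin_rel_add lin_rel_diff A)
    then have cd: "(c, c' + d) \<in> A" using az zd by simp
    have len: "length xs = length ys" "length ys = length lams"
      using ys by (auto dest: list_all2_lengthD)
    let ?ps = "(c, c' + d) # zip xs ys @ [(a, z), (u, v)]"
    have "list_all2 (\<in>) (zip xs ys) (map (graph_restriction A) (map X lams))"
      using xs ys len by (auto simp: list_all2_conv_all_nth graph_restriction_def)
    moreover have "(c, c' + d) \<in> graph_restriction A (Rc A)"
      using cd mem c' zd subspace_add[OF sRc] by (auto simp: graph_restriction_def)
    moreover have "(a, z) \<in> graph_restriction A Y" "(u, v) \<in> graph_restriction A M"
      using az z' zd uv by (auto simp: graph_restriction_def)
    ultimately have "list_all2 (\<in>) ?ps (map (graph_restriction A) ?Hs)"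
      by (auto intro!: list_all2_appendI)
    moreover have "(x, y) = sum_list ?ps"
    proof (rule prod_eqI)
      have "x = (x - u) + u" by simp
      then show "fst (x, y) = fst (sum_list ?ps)"
        unfolding fst_sum_list using xu len by (simp add: add.assoc)
      have "y = c' + sum_list ys + w + v" by (simp add: w_def)
      then show "snd (x, y) = snd (sum_list ?ps)"
        unfolding snd_sum_list using zd len by (simp add: algebra_simps)
    qed
    ultimately show "(x, y) \<in> sum_list (map (graph_restriction A) ?Hs)"
      unfolding mem_sum_list_iff by blast
  qed
  moreover have "sum_list (map (graph_restriction A) ?Hs) \<subseteq> A"
  proof
    fix p assume "p \<in> sum_list (map (graph_restriction A) ?Hs)"
    then obtain ps where ps: "list_all2 (\<in>) ps (map (graph_restriction A) ?Hs)" "p = sum_list ps"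
      unfolding mem_sum_list_iff by blast
    have "set ps \<subseteq> A"
    proof
      fix q assume "q \<in> set ps"
      then obtain i where "i < length ps" "q = ps ! i" by (metis in_set_conv_nth)
      then have "q \<in> map (graph_restriction A) ?Hs ! i" "i < length ?Hs"
        using list_all2_nthD[OF ps(1)] list_all2_lengthD[OF ps(1)] by auto
      then show "q \<in> A" by (simp only: nth_map) (simp add: graph_restriction_def)
    qed
    then show "p \<in> A" unfolding ps(2) by (rule lin_rel_sum_list_mem[OF A])
  qed
  ultimately have "A = sum_list (map (graph_restriction A) ?Hs)" by (rule subset_antisym)
  then show "reducing_sum_decomposition s A ?Hs (map (graph_restriction A) ?Hs)"
    unfolding reducing_sum_decomposition_def is_direct_sum_def
    using sHs ind independent_graph_restrictions[OF ind, of A] by blast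
qed

lemma kronecker_decomposition:
  assumes A: "lin_rel A" and lams: "distinct lams"
    and proper: "set lams = {c. Fin c \<in> proper_point_spectrum s A}"
  shows "\<exists>X Y M.
    (\<forall>c\<in>set lams. \<exists>x. jordan_system s A c x \<and> X c = jordan_system_span s A c x) \<and>
    (if Infty \<in> proper_point_spectrum s A
     then \<exists>x. jordan_system_inf s A x \<and> Y = jordan_system_inf_span s A x else Y = {0}) \<and>
    (if total_root_space s A = Domain A + Range A
     then M = {0} else \<exists>x. shift_system s A x \<and> M = shift_system_span s A x) \<and>
    is_direct_sum (Domain A + Range A) (Rc A # map X lams @ [Y, M]) \<and>
    reducing_sum_decomposition s A (Rc A # map X lams @ [Y, M])
      (map (graph_restriction A) (Rc A # map X lams @ [Y, M])) \<and>
    (\<forall>c\<in>set lams. X c \<noteq> {0} \<longrightarrow> jordan_operator_in s (X c) c (graph_restriction A (X c))) \<and>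
    (Y \<noteq> {0} \<longrightarrow> jordan_relation_in s Y (graph_restriction A Y)) \<and>
    multishift_in s M (graph_restriction A M)"
proof -
  let ?R = "total_root_space s A"
  obtain f where f: "\<And>c. jordan_system s A c (f c) \<and>
    nul (rel_minus s A c) = jordan_system_span s A c (f c) + Rc A \<and>
    jordan_system_span s A c (f c) \<inter> Rc A \<subseteq> {0} \<and>
    (\<forall>u\<in>jordan_system_span s A c (f c). \<exists>v\<in>jordan_system_span s A c (f c). (u, v) \<in> rel_minus s A c) \<and>
    (jordan_system_span s A c (f c) \<noteq> {0} \<longrightarrow>
      (\<exists>u\<in>jordan_system_span s A c (f c). u \<noteq> 0 \<and> (u, 0) \<in> rel_minus s A c))"
    using jordan_system_exists[OF A] by metis
  define X where "X c = jordan_system_span s A c (f c)" for c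
  have X: "subspace (X c)" "nul (rel_minus s A c) = X c + Rc A" "X c \<inter> Rc A \<subseteq> {0}"
    "\<forall>u\<in>X c. \<exists>v\<in>X c. (u, v) \<in> rel_minus s A c"
    "X c \<noteq> {0} \<Longrightarrow> \<exists>u\<in>X c. u \<noteq> 0 \<and> (u, 0) \<in> rel_minus s A c" for c
    using f[of c] unfolding X_def by (simp_all add: jordan_system_span_def)
  have "\<exists>Y. (if Infty \<in> proper_point_spectrum s A
     then \<exists>x. jordan_system_inf s A x \<and> Y = jordan_system_inf_span s A x else Y = {0}) \<and>
    subspace Y \<and> nul (A\<inverse>) = Y + Rc A \<and> Y \<inter> Rc A \<subseteq> {0} \<and> (\<forall>u\<in>Y. \<exists>v\<in>Y. (u, v) \<in> A\<inverse>) \<and>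
    (Y \<noteq> {0} \<longrightarrow> (\<exists>u\<in>Y. u \<noteq> 0 \<and> (u, 0) \<in> A\<inverse>))"
  proof (cases "Infty \<in> proper_point_spectrum s A")
    case True
    obtain x where "jordan_system s (A\<inverse>) 0 x \<and>
      nul (A\<inverse>) = jordan_system_span s (A\<inverse>) 0 x + Rc A \<and> jordan_system_span s (A\<inverse>) 0 x \<inter> Rc A \<subseteq> {0} \<and>
      (\<forall>u\<in>jordan_system_span s (A\<inverse>) 0 x. \<exists>v\<in>jordan_system_span s (A\<inverse>) 0 x. (u, v) \<in> A\<inverse>) \<and>
      (jordan_system_span s (A\<inverse>) 0 x \<noteq> {0} \<longrightarrow>
        (\<exists>u\<in>jordan_system_span s (A\<inverse>) 0 x. u \<noteq> 0 \<and> (u, 0) \<in> A\<inverse>))"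
      using jordan_system_exists[OF lin_rel_converse[OF A], of 0] by (simp only: rel_minus_0 Rc_converse) blast
    moreover have "subspace (jordan_system_span s (A\<inverse>) 0 x)" by (simp add: jordan_system_span_def)
    ultimately show ?thesis
      using True jordan_system_inf_iff[OF A, of x] jordan_system_inf_span_eq[OF A, of x]
      by (intro exI[of _ "jordan_system_span s (A\<inverse>) 0 x"]) auto
  next
    case False
    \<comment> \<open>Outside the proper point spectrum the root space at infinity has nothing
      beyond \<open>Rc A\<close>, so the zero space fulfils all conditions on
      \<open>Y\<close>.\<close>
    then have "nul (A\<inverse>) = Rc A" using nul_converse_subset_Rc[OF A] by (auto simp: Rc_def)
    moreover have "(0, 0) \<in> A" using lin_rel_0[OF A] .
    ultimately show ?thesis using False by (intro exI[of _ "{0}"]) auto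
  qed
  then obtain Y where Ysys: "if Infty \<in> proper_point_spectrum s A
     then \<exists>x. jordan_system_inf s A x \<and> Y = jordan_system_inf_span s A x else Y = {0}"
    and Y: "subspace Y" "nul (A\<inverse>) = Y + Rc A" "Y \<inter> Rc A \<subseteq> {0}" "\<forall>u\<in>Y. \<exists>v\<in>Y. (u, v) \<in> A\<inverse>"
      "Y \<noteq> {0} \<Longrightarrow> \<exists>u\<in>Y. u \<noteq> 0 \<and> (u, 0) \<in> A\<inverse>" by blast
  have "\<exists>M. (if ?R = Domain A + Range A then M = {0}
      else \<exists>x. shift_system s A x \<and> M = shift_system_span s A x) \<and>
    subspace M \<and> Domain A + Range A = M + ?R \<and> M \<inter> ?R \<subseteq> {0} \<and>
    (\<forall>a b. (a, b) \<in> A \<longrightarrow> (\<exists>u\<in>M. \<exists>v\<in>M. (u, v) \<in> A \<and> b - v \<in> ?R))"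
  proof (cases "?R = Domain A + Range A")
    case True
    \<comment> \<open>With the range inside the root spaces, the pair \<open>(0, 0)\<close> already
      reduces every second component.\<close>
    have "Range A \<subseteq> ?R" unfolding True using lin_rel_0[OF A] by (intro set_zero_plus2) blast
    then show ?thesis using True lin_rel_0[OF A] by (intro exI[of _ "{0}"]) auto
  next
    case False
    obtain x where "shift_system s A x \<and>
      Domain A + Range A = shift_system_span s A x + ?R \<and> shift_system_span s A x \<inter> ?R \<subseteq> {0} \<and>
      (\<forall>a b. (a, b) \<in> A \<longrightarrow> (\<exists>u\<in>shift_system_span s A x. \<exists>v\<in>shift_system_span s A x.
      (u, v) \<in> A \<and> b - v \<in> ?R))"
      using shift_system_exists[OF A] by blast
    moreover have "subspace (shift_system_span s A x)" by (simp add: shift_system_span_def)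
    ultimately show ?thesis using False by (intro exI[of _ "shift_system_span s A x"]) auto
  qed
  then obtain M where Msys: "if ?R = Domain A + Range A then M = {0}
      else \<exists>x. shift_system s A x \<and> M = shift_system_span s A x"
    and M: "subspace M" "Domain A + Range A = M + ?R" "M \<inter> ?R \<subseteq> {0}"
    "\<forall>a b. (a, b) \<in> A \<longrightarrow> (\<exists>u\<in>M. \<exists>v\<in>M. (u, v) \<in> A \<and> b - v \<in> ?R)" by blast
  have dec: "is_direct_sum (Domain A + Range A) (Rc A # map X lams @ [Y, M])"
    "reducing_sum_decomposition s A (Rc A # map X lams @ [Y, M])
      (map (graph_restriction A) (Rc A # map X lams @ [Y, M]))"
    using X Y M by (intro decomposition A lams proper; auto)+
  have Xsub: "X c \<subseteq> nul (rel_minus s A c)" for c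
    using X(2) set_zero_plus2[OF subspace_0[OF subspace_Rc[OF A]], of "X c"] by (simp add: add.commute)
  have Ysub: "Y \<subseteq> nul (A\<inverse>)"
    using Y(2) set_zero_plus2[OF subspace_0[OF subspace_Rc[OF A]], of Y] by (simp add: add.commute)
  have J: "jordan_operator_in s (X c) c (graph_restriction A (X c))" if "X c \<noteq> {0}" for c
    using X that Xsub by (intro jordan_operator_restriction A) auto
  \<comment> \<open>The finite case is applied to the inverse at 0, as a Jordan relation is by
    definition the inverse of a Jordan operator at 0.\<close>
  have "jordan_operator_in s Y 0 (graph_restriction (A\<inverse>) Y)" if "Y \<noteq> {0}"
    using Y that Ysub by (intro jordan_operator_restriction lin_rel_converse A) auto
  then have Jinf: "jordan_relation_in s Y (graph_restriction A Y)" if "Y \<noteq> {0}"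
    using that by (simp add: jordan_relation_in_def converse_graph_restriction)
  have Xsys: "\<forall>c\<in>set lams. \<exists>x. jordan_system s A c x \<and> X c = jordan_system_span s A c x"
    using f X_def by blast
  show ?thesis
    by (rule exI[of _ X], rule exI[of _ Y], rule exI[of _ M])
      (use Xsys Ysys Msys dec J Jinf multishift_restriction[OF A M(1,3)] in blast)
qed

end

theorem theorem6p1:
  fixes s :: "complex \<Rightarrow> 'v::ab_group_add \<Rightarrow> 'v"
    and Basis :: "'v set"
    and A :: "('v \<times> 'v) set"
    and lams :: "complex list"
  assumes "finite_dimensional_vector_space s Basis"
    and "linear_relation_in s UNIV A"
    and "distinct lams"
    and "set lams = {c. Fin c \<in> proper_point_spectrum s A}"
  shows "\<exists>(X :: complex \<Rightarrow> 'v set) Xinf Rm.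
    (\<forall>c\<in>set lams. \<exists>x. jordan_system s A c x \<and> X c = jordan_system_span s A c x) \<and>
    (if Infty \<in> proper_point_spectrum s A
     then \<exists>x. jordan_system_inf s A x \<and> Xinf = jordan_system_inf_span s A x
     else Xinf = {0}) \<and>
    (if total_root_space s A = Domain A + Range A
     then Rm = {0}
     else \<exists>x. shift_system s A x \<and> Rm = shift_system_span s A x) \<and>
    is_direct_sum (Domain A + Range A)
      (singular_chain_space s A # map X lams @ [Xinf, Rm]) \<and>
    (let AS = graph_restriction A (singular_chain_space s A);
         J = (\<lambda>c. graph_restriction A (X c));
         Jinf = graph_restriction A Xinf;
         AM = graph_restriction A Rm
     in
       reducing_sum_decomposition s A
         (singular_chain_space s A # map X lams @ [Xinf, Rm])
         (AS # map J lams @ [Jinf, AM]) \<and>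
       (singular_chain_space s A \<noteq> {0} \<longrightarrow>
          completely_singular_in s (singular_chain_space s A) AS) \<and>
       (\<forall>c\<in>set lams. X c \<noteq> {0} \<longrightarrow> jordan_operator_in s (X c) c (J c)) \<and>
       (Xinf \<noteq> {0} \<longrightarrow> jordan_relation_in s Xinf Jinf) \<and>
       (Rm \<noteq> {0} \<longrightarrow> multishift_in s Rm AM))"
proof -
  interpret complex_fd_space s Basis by (simp add: complex_fd_space_def assms(1))
  have A: "lin_rel A" using assms(2) by (simp add: linear_relation_in_iff)
  have maps: "map (graph_restriction A) (Rc A # map X lams @ [Y, M]) =
      graph_restriction A (Rc A) # map (\<lambda>c. graph_restriction A (X c)) lams @
        [graph_restriction A Y, graph_restriction A M]" for X Y M
    by simp
  show ?thesis
    unfolding singular_chain_space_eq[OF A] Let_def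
    using kronecker_decomposition[OF A assms(3,4), unfolded maps] completely_singular_restriction[OF A]
    by blast
qed

end
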